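(* Let $M$ be a matroid that is realizable over some field. (i) If $M$ is a sticky matroid, then $M$ is modular. (ii) If $M$ is hypermodular, then $M$ is embeddable in a modular matroid, i.e. $M$ is isomorphic to a restriction of some modular matroid.
   Context: All matroids are finite. A matroid is realizable if it is representable over some field. For a matroid with rank function $r$, a pair of flats $\{A,B\}$ is modular if $r(A\cup B)+r(A\cap B)=r(A)+r(B)$; a flat $F$ is modular if $\{F,L\}$ is a modular pair for every flat $L$; the matroid is modular if every flat is modular. A matroid of rank $k\ge 3$ is hypermodular if every pair of two corank-$1$ flats (flats of rank $k-1$) is a modular pair. A matroid $M$ is sticky if for any two matroids $N_1,N_2$ with $E(N_1)\cap E(N_2)=E(M)$ and $N_1|_{E(M)}=N_2|_{E(M)}=M$, there exists a matroid $N$ on $E(N_1)\cup E(N_2)$ with $N|_{E(N_1)}=N_1$ and $N|_{E(N_2)}=N_2$ (an amalgam of $N_1$ and $N_2$). *)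

theory Defs
  imports Main "HOL-Library.Infinite_Typeclass" "HOL-Library.Function_Algebras"
begin

record 'a set_system =
  ground :: "'a set"
  indeps :: "'a set set"

locale matroid =
  fixes M :: "'a set_system"
  assumes finite_ground: "finite (ground M)"
    and indeps_subset_ground: "I \<in> indeps M \<Longrightarrow> I \<subseteq> ground M"
    and empty_indep: "{} \<in> indeps M"
    and indep_subset: "I \<in> indeps M \<Longrightarrow> J \<subseteq> I \<Longrightarrow> J \<in> indeps M"
    and augment: "I \<in> indeps M \<Longrightarrow> J \<in> indeps M \<Longrightarrow> card I < card J \<Longrightarrow>
                    \<exists>x\<in>J - I. insert x I \<in> indeps M"

definition rank :: "'a set_system \<Rightarrow> 'a set \<Rightarrow> nat" where
  "rank M X = Max (card ` {I \<in> indeps M. I \<subseteq> X})"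

definition flat :: "'a set_system \<Rightarrow> 'a set \<Rightarrow> bool" where
  "flat M F \<longleftrightarrow> F \<subseteq> ground M \<and> (\<forall>x\<in>ground M - F. rank M F < rank M (insert x F))"

definition modular_pair :: "'a set_system \<Rightarrow> 'a set \<Rightarrow> 'a set \<Rightarrow> bool" where
  "modular_pair M A B \<longleftrightarrow> rank M (A \<union> B) + rank M (A \<inter> B) = rank M A + rank M B"

definition modular_flat :: "'a set_system \<Rightarrow> 'a set \<Rightarrow> bool" where
  "modular_flat M F \<longleftrightarrow> flat M F \<and> (\<forall>L. flat M L \<longrightarrow> modular_pair M F L)"

definition modular :: "'a set_system \<Rightarrow> bool" where
  "modular M \<longleftrightarrow> (\<forall>F. flat M F \<longrightarrow> modular_flat M F)"

definition hypermodular :: "'a set_system \<Rightarrow> bool" where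
  "hypermodular M \<longleftrightarrow> rank M (ground M) \<ge> 3 \<and>
     (\<forall>A B. flat M A \<and> flat M B \<and>
        rank M A = rank M (ground M) - 1 \<and> rank M B = rank M (ground M) - 1 \<longrightarrow>
        modular_pair M A B)"

definition restriction :: "'a set_system \<Rightarrow> 'a set \<Rightarrow> 'a set_system" where
  "restriction M S = \<lparr>ground = ground M \<inter> S, indeps = {I \<in> indeps M. I \<subseteq> S}\<rparr>"

definition is_amalgam ::
  "'a set_system \<Rightarrow> 'a set_system \<Rightarrow> 'a set_system \<Rightarrow> bool" where
  "is_amalgam N N1 N2 \<longleftrightarrow> matroid N \<and> ground N = ground N1 \<union> ground N2 \<and>
     restriction N (ground N1) = N1 \<and> restriction N (ground N2) = N2"

text \<open>The extensions \<open>N1\<close> and \<open>N2\<close> live on the type of \<open>M\<close>. Since all matroids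
  here are finite, the sort constraint guarantees that every pair of extensions has, up to
  relabelling the elements outside \<open>ground M\<close>, a copy on this type. On a finite type the
  condition would be too weak.\<close>

definition sticky :: "'a::infinite set_system \<Rightarrow> bool" where
  "sticky M \<longleftrightarrow> (\<forall>N1 N2. matroid N1 \<and> matroid N2 \<and> ground N1 \<inter> ground N2 = ground M \<and>
      restriction N1 (ground M) = M \<and> restriction N2 (ground M) = M \<longrightarrow>
      (\<exists>N. is_amalgam N N1 N2))"

definition isomorphic :: "'a set_system \<Rightarrow> 'b set_system \<Rightarrow> bool" where
  "isomorphic M N \<longleftrightarrow> (\<exists>f. bij_betw f (ground M) (ground N) \<and>
     (\<forall>X\<subseteq>ground M. X \<in> indeps M \<longleftrightarrow> f ` X \<in> indeps N))"

text \<open>As matroids are finite, ground sets in \<open>nat\<close> cover all modular matroids up to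
  isomorphism.\<close>

definition embeddable_in_modular :: "'a set_system \<Rightarrow> bool" where
  "embeddable_in_modular M \<longleftrightarrow> (\<exists>(N :: nat set_system) S. matroid N \<and> modular N \<and>
     S \<subseteq> ground N \<and> isomorphic M (restriction N S))"

definition scale_fun :: "'k::field \<Rightarrow> ('i \<Rightarrow> 'k) \<Rightarrow> 'i \<Rightarrow> 'k" where
  "scale_fun c v = (\<lambda>i. c * v i)"

lemma vector_space_scale_fun: "vector_space scale_fun"
  by unfold_locales (auto simp: scale_fun_def fun_eq_iff algebra_simps)

text \<open>The space \<open>k\<^sup>n\<close> is the space of functions \<open>nat \<Rightarrow> 'k\<close> vanishing from \<open>n\<close> on.
  Because \<open>module.dependent\<close> speaks about sets of vectors, injectivity is needed to express
  independence of the family \<open>\<phi>\<close> on \<open>X\<close> (parallel elements may share a vector).\<close>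

definition realizable_over :: "'k::field itself \<Rightarrow> 'a set_system \<Rightarrow> bool" where
  "realizable_over K M \<longleftrightarrow> (\<exists>(n::nat) (\<phi> :: 'a \<Rightarrow> nat \<Rightarrow> 'k).
     (\<forall>x\<in>ground M. \<forall>i\<ge>n. \<phi> x i = 0) \<and>
     (\<forall>X\<subseteq>ground M. X \<in> indeps M \<longleftrightarrow>
        inj_on \<phi> X \<and> \<not> module.dependent scale_fun (\<phi> ` X)))"

end

theory Submission
  imports Defs "HOL-Computational_Algebra.Polynomial" "HOL-Computational_Algebra.Primes"
begin

text \<open>
  (i) If \<open>M\<close> is not modular, some pair of flats \<open>A\<close>, \<open>B\<close> has defect exactly one, and in a
  realization the spans of \<open>A\<close> and \<open>B\<close> meet in a vector \<open>e\<close> outside the span of \<open>A \<inter> B\<close>.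
  One extension of \<open>M\<close> adds a point \<open>f\<close> placed freely on the flat spanned by \<open>A \<inter> B\<close> and
  \<open>e\<close>. The other one adds two large sets \<open>C\<close> and \<open>D\<close> in the manner of the Vamos matroid: in an
  amalgam, submodularity would force \<open>f\<close> into the closures of \<open>(A \<inter> B) \<union> C\<close> and of
  \<open>(A \<inter> B) \<union> D\<close>, which are too skew over \<open>A \<inter> B\<close> to share it.

  (ii) Every matroid realizable over a field is realizable over a finite field, and hence
  embeds into the matroid of all vectors of a finite vector space, which is modular. The reduction
  uses that every finite subset of a field lies in a subring with a finite residue field.
\<close>

section \<open>Rank and closure\<close>

text \<open>The vector \<open>e\<close> itself could not serve as the extra point. It may lie on a
  circuit with very few elements of \<open>M\<close>, and then charging it only once for
  \<open>C\<close> and \<open>D\<close> together can violate the exchange axiom. In its free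
  position, \<open>f\<close> lies only on circuits with more than \<open>x + 2\<close> elements,
  where \<open>x\<close> is the rank of \<open>A \<inter> B\<close>. A truncation at rank
  \<open>n\<close>, the size of \<open>C \<union> D\<close> plus \<open>x\<close>, tolerates exactly
  this. The final count has no slack: the contradiction is by one. A larger defect of
  \<open>A\<close> and \<open>B\<close> would use up that surplus, which is why a pair of defect
  exactly one is isolated. In (ii), the mere existence of a finite residue field is too weak for an
  induction over the generators of the subring. After \<open>t\<close> is adjoined, the ideal must
  avoid elements that depend on \<open>t\<close>, such as a leading coefficient. The induction
  therefore carries, for each nonzero element, a residue field in which it survives.\<close>

context matroid
begin

lemma indep_finite: "I \<in> indeps M \<Longrightarrow> finite I"
  using finite_ground indeps_subset_ground finite_subset by blast

lemma finite_indeps_within: "finite {I \<in> indeps M. I \<subseteq> X}"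
  by (rule finite_subset[of _ "Pow (ground M)"]) (use finite_ground indeps_subset_ground in auto)

lemma card_indep_le_rank: "I \<in> indeps M \<Longrightarrow> I \<subseteq> X \<Longrightarrow> card I \<le> rank M X"
  unfolding rank_def using finite_indeps_within[of X] by (intro Max_ge) auto

lemma obtain_basis:
  obtains B where "B \<in> indeps M" "B \<subseteq> X" "card B = rank M X"
proof -
  have "card ` {I \<in> indeps M. I \<subseteq> X} \<noteq> {}" using empty_indep by blast
  then have "rank M X \<in> card ` {I \<in> indeps M. I \<subseteq> X}"
    unfolding rank_def using finite_indeps_within[of X] by (intro Max_in) auto
  then show ?thesis using that by auto
qed

lemma extend_to_basis:
  assumes "I \<in> indeps M" "I \<subseteq> X"
  obtains B where "I \<subseteq> B" "B \<in> indeps M" "B \<subseteq> X" "card B = rank M X"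
proof -
  have "\<exists>B. I \<subseteq> B \<and> B \<in> indeps M \<and> B \<subseteq> X \<and> card B = rank M X"
    using assms
  proof (induction "rank M X - card I" arbitrary: I rule: less_induct)
    case less
    have le: "card I \<le> rank M X" using card_indep_le_rank less.prems by blast
    show ?case
    proof (cases "card I = rank M X")
      case True
      then show ?thesis using less.prems by blast
    next
      case False
      then have lt: "card I < rank M X" using le by simp
      obtain B where B: "B \<in> indeps M" "B \<subseteq> X" "card B = rank M X" by (rule obtain_basis)
      obtain x where x: "x \<in> B - I" "insert x I \<in> indeps M"
        using augment[of I B] less.prems B lt by auto
      have c: "card (insert x I) = Suc (card I)" using x indep_finite less.prems by auto
      have sub: "insert x I \<subseteq> X" using x B less.prems by auto
      have "rank M X - card (insert x I) < rank M X - card I" using c lt by simp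
      from less.hyps[OF this x(2) sub] show ?thesis by blast
    qed
  qed
  then show ?thesis using that by blast
qed

lemma rank_mono: "X \<subseteq> Y \<Longrightarrow> rank M X \<le> rank M Y"
proof -
  assume sub: "X \<subseteq> Y"
  obtain B where "B \<in> indeps M" "B \<subseteq> X" "card B = rank M X" by (rule obtain_basis)
  then show ?thesis using card_indep_le_rank[of B Y] sub by auto
qed

lemma rank_insert_ge: "rank M S \<le> rank M (insert x S)"
  by (rule rank_mono) auto

lemma rank_le_card: "finite X \<Longrightarrow> rank M X \<le> card X"
proof -
  assume fin: "finite X"
  obtain B where "B \<in> indeps M" "B \<subseteq> X" "card B = rank M X" by (rule obtain_basis)
  then show ?thesis using card_mono[of X B] fin by auto
qed

lemma rank_indep: "I \<in> indeps M \<Longrightarrow> rank M I = card I"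
  by (simp add: card_indep_le_rank indep_finite le_antisym rank_le_card)

lemma rank_submodular: "rank M (X \<union> Y) + rank M (X \<inter> Y) \<le> rank M X + rank M Y"
proof -
  obtain I where I: "I \<in> indeps M" "I \<subseteq> X \<inter> Y" "card I = rank M (X \<inter> Y)" by (rule obtain_basis)
  have "I \<subseteq> X \<union> Y" using I by blast
  then obtain B where B: "I \<subseteq> B" "B \<in> indeps M" "B \<subseteq> X \<union> Y" "card B = rank M (X \<union> Y)"
    by (rule extend_to_basis[OF I(1)])
  have fin: "finite B" using B indep_finite by blast
  have "card (B \<inter> X) + card (B \<inter> Y) = card (B \<inter> X \<union> B \<inter> Y) + card (B \<inter> X \<inter> (B \<inter> Y))"
    using fin by (intro card_Un_Int) auto
  also have "B \<inter> X \<union> B \<inter> Y = B" using B by blast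
  finally have "card (B \<inter> X) + card (B \<inter> Y) = card B + card (B \<inter> X \<inter> (B \<inter> Y))" .
  moreover have "card I \<le> card (B \<inter> X \<inter> (B \<inter> Y))" using B I fin by (intro card_mono) auto
  ultimately have "card B + card I \<le> card (B \<inter> X) + card (B \<inter> Y)" by simp
  moreover have "card (B \<inter> X) \<le> rank M X" "card (B \<inter> Y) \<le> rank M Y"
    using B indep_subset by (auto intro!: card_indep_le_rank)
  ultimately show ?thesis using B I by simp
qed

lemma rank_insert_le: "rank M (insert x S) \<le> Suc (rank M S)"
proof -
  have "rank M {x} \<le> 1" using rank_le_card[of "{x}"] by simp
  then show ?thesis using rank_submodular[of "{x}" S] by simp
qed

text \<open>Otherwise a basis of \<open>S\<close> could be augmented from a larger basis of
  \<open>S \<union> T\<close>, and the added element alone would already raise the rank of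
  \<open>S\<close>.\<close>

lemma rank_union_absorb:
  assumes "\<And>x. x \<in> T \<Longrightarrow> rank M (insert x S) = rank M S"
  shows "rank M (S \<union> T) = rank M S"
proof (rule ccontr)
  assume "rank M (S \<union> T) \<noteq> rank M S"
  then have lt: "rank M S < rank M (S \<union> T)" using rank_mono[of S "S \<union> T"] by auto
  obtain B where B: "B \<in> indeps M" "B \<subseteq> S" "card B = rank M S" by (rule obtain_basis)
  obtain B' where B': "B' \<in> indeps M" "B' \<subseteq> S \<union> T" "card B' = rank M (S \<union> T)"
    by (rule obtain_basis)
  obtain x where x: "x \<in> B' - B" "insert x B \<in> indeps M" using augment[of B B'] lt B B' by auto
  have "rank M S < rank M (insert x S)"
    using card_indep_le_rank[of "insert x B" "insert x S"] x B indep_finite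
    by (auto simp: subset_insertI2)
  moreover have "x \<in> S \<union> T" using x B' by blast
  ultimately show False using assms by (auto simp: insert_absorb)
qed

lemma rank_insert_absorb_mono:
  assumes "rank M (insert x S) = rank M S" "S \<subseteq> T"
  shows "rank M (insert x T) = rank M T"
proof (cases "x \<in> T")
  case True
  then show ?thesis by (simp add: insert_absorb)
next
  case False
  then have "insert x S \<inter> T = S" "insert x S \<union> T = insert x T" using assms by auto
  then have "rank M (insert x T) \<le> rank M T" using rank_submodular[of "insert x S" T] assms by simp
  then show ?thesis using rank_insert_ge[of T x] by simp
qed

lemma indep_insertI:
  assumes "I \<in> indeps M" "x \<in> ground M" "rank M (insert x I) \<noteq> rank M I"
  shows "insert x I \<in> indeps M"
proof -
  have "rank M I < rank M (insert x I)" using rank_insert_ge[of I x] assms by simp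
  moreover obtain B where B: "B \<in> indeps M" "B \<subseteq> insert x I" "card B = rank M (insert x I)"
    by (rule obtain_basis)
  ultimately have "card I < card B" using rank_indep assms by simp
  then obtain y where "y \<in> B - I" "insert y I \<in> indeps M" using augment assms B by blast
  then show ?thesis using B by auto
qed

lemma rank_insert_indep:
  assumes "insert x I \<in> indeps M" "x \<notin> I"
  shows "rank M (insert x I) = Suc (rank M I)"
proof -
  have "I \<in> indeps M" using assms indep_subset by blast
  then show ?thesis using assms by (simp add: rank_indep indep_finite)
qed

section \<open>Closure, exchange and flats\<close>

definition closure :: "'a set \<Rightarrow> 'a set" where
  "closure S = {x \<in> ground M. rank M (insert x S) = rank M S}"

lemma closure_subset_ground: "closure S \<subseteq> ground M"
  by (auto simp: closure_def)

lemma subset_closure: "S \<subseteq> ground M \<Longrightarrow> S \<subseteq> closure S"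
  by (auto simp: closure_def insert_absorb)

lemma closure_mono: "S \<subseteq> T \<Longrightarrow> closure S \<subseteq> closure T"
  unfolding closure_def using rank_insert_absorb_mono by blast

lemma rank_union_closure: "T \<subseteq> closure S \<Longrightarrow> rank M (S \<union> T) = rank M S"
  by (rule rank_union_absorb) (auto simp: closure_def)

lemma rank_closure: "S \<subseteq> ground M \<Longrightarrow> rank M (closure S) = rank M S"
  using rank_union_closure[of "closure S" S] subset_closure[of S] by (simp add: sup.absorb2)

lemma closure_closure:
  assumes "S \<subseteq> ground M" shows "closure (closure S) = closure S"
proof
  show "closure (closure S) \<subseteq> closure S"
  proof
    fix x assume x: "x \<in> closure (closure S)"
    then have "rank M (insert x (closure S)) = rank M S"
      using rank_closure[OF assms] by (simp add: closure_def)
    moreover have "rank M (insert x S) \<le> rank M (insert x (closure S))"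
      using subset_closure[OF assms] by (intro rank_mono) auto
    ultimately show "x \<in> closure S" using x rank_insert_ge[of S x] by (simp add: closure_def)
  qed
qed (use subset_closure closure_subset_ground in blast)

lemma closure_subset_closure: "S \<subseteq> ground M \<Longrightarrow> T \<subseteq> closure S \<Longrightarrow> closure T \<subseteq> closure S"
  using closure_mono[of T "closure S"] closure_closure by simp

lemma closure_exchange:
  assumes "S \<subseteq> ground M" "y \<in> ground M" "x \<in> closure (insert y S)" "x \<notin> closure S"
  shows "y \<in> closure (insert x S)"
proof -
  have x: "x \<in> ground M" using assms by (simp add: closure_def)
  then have "rank M S < rank M (insert x S)"
    using assms rank_insert_ge[of S x] by (auto simp: closure_def)
  moreover have "rank M (insert y (insert x S)) = rank M (insert y S)"
    using assms by (simp add: closure_def insert_commute)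
  moreover have "rank M (insert x S) \<le> rank M (insert y (insert x S))" by (intro rank_mono) auto
  ultimately show ?thesis using rank_insert_le[of y S] assms by (auto simp: closure_def)
qed

text \<open>A common element \<open>z\<close> outside \<open>closure S\<close> could be exchanged
  for \<open>u\<close>, which would put \<open>u\<close> into the closure of
  \<open>insert z S\<close> and hence into that of \<open>insert t S\<close>.\<close>

lemma closure_insert_Int:
  assumes "S \<subseteq> ground M" "t \<in> ground M" "u \<in> ground M" "u \<notin> closure (insert t S)"
  shows "closure (insert t S) \<inter> closure (insert u S) \<subseteq> closure S"
proof (rule ccontr)
  assume "\<not> ?thesis"
  then obtain z where z: "z \<in> closure (insert t S)" "z \<in> closure (insert u S)" "z \<notin> closure S"
    by blast
  have "u \<in> closure (insert z S)" using closure_exchange z assms by blast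
  also have "\<dots> \<subseteq> closure (insert t S)"
    by (rule closure_subset_closure) (use z assms subset_closure[of "insert t S"] in auto)
  finally show False using assms by simp
qed

lemma flat_iff: "flat M F \<longleftrightarrow> F \<subseteq> ground M \<and> closure F = F"
proof -
  have "rank M F < rank M (insert x F) \<longleftrightarrow> rank M (insert x F) \<noteq> rank M F" for x
    using rank_insert_ge[of F x] by auto
  then show ?thesis unfolding flat_def closure_def by (auto simp: insert_absorb)
qed

lemma flat_closure: "S \<subseteq> ground M \<Longrightarrow> flat M (closure S)"
  by (simp add: flat_iff closure_subset_ground closure_closure)

lemma indep_insert_iff:
  assumes "I \<in> indeps M" "x \<in> ground M" "x \<notin> I"
  shows "insert x I \<in> indeps M \<longleftrightarrow> x \<notin> closure I"
  using indep_insertI[of I x] rank_insert_indep[of x I] assms by (auto simp: closure_def)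

text \<open>Independence and size make \<open>I\<close> a basis of the flat spanned by
  \<open>J\<close>, so it spans the whole flat.\<close>

lemma subset_closure_of_max:
  assumes "I \<in> indeps M" "J \<in> indeps M" "I \<subseteq> closure J" "card J \<le> card I"
  shows "closure J \<subseteq> closure I"
proof -
  have sub: "I \<subseteq> ground M" "J \<subseteq> ground M" using assms indeps_subset_ground by auto
  have "rank M (closure J) = rank M I"
    using rank_closure[of J] rank_mono[OF assms(3)] rank_indep assms sub by simp
  moreover have "rank M (insert x I) \<le> rank M (closure J)" if "x \<in> closure J" for x
    using that assms by (intro rank_mono) auto
  ultimately have "rank M (insert x I) = rank M I" if "x \<in> closure J" for x
    using that rank_insert_ge[of I x] by (metis le_antisym)
  then show ?thesis using closure_subset_ground[of J] by (auto simp: closure_def[of I])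
qed

end

lemma rank_restriction:
  assumes "matroid N" "restriction N S = M" "X \<subseteq> S"
  shows "rank N X = rank M X"
proof -
  have "{I \<in> indeps M. I \<subseteq> X} = {I \<in> indeps N. I \<subseteq> X}"
    using assms by (auto simp: restriction_def)
  then show ?thesis by (simp add: rank_def)
qed

section \<open>Amalgams that do not exist\<close>

text \<open>No element is added: \<open>e\<close> is an existing element that is moved to a generic
  position on the flat spanned by \<open>Z\<close>, so it becomes dependent only on sets that span
  all of \<open>Z\<close> in \<open>M\<close>. As \<open>Z\<close> may contain \<open>e\<close>, the
  old position of \<open>e\<close> can help to define the flat.\<close>

definition principal_extension :: "'a set_system \<Rightarrow> 'a \<Rightarrow> 'a set \<Rightarrow> 'a set_system" where
  "principal_extension M e Z = \<lparr>ground = ground M,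
     indeps = {S. S - {e} \<in> indeps M \<and> (e \<in> S \<longrightarrow> \<not> Z \<subseteq> matroid.closure M (S - {e}))}\<rparr>"

text \<open>Augmentation is the only real issue, and its hard case is \<open>e\<close> in
  \<open>I\<close>. If \<open>t\<close> and \<open>u\<close> from \<open>T\<close> extended
  \<open>S\<close> in different directions, both closures would contain \<open>Z\<close>, and then
  so would \<open>closure S\<close>, which contains their intersection. Hence \<open>T\<close> lies
  in the closure of \<open>insert t S\<close>; counting forces \<open>e\<close> into
  \<open>J\<close> and makes \<open>T\<close> span \<open>Z\<close>, which \<open>J\<close>
  forbids.\<close>

lemma (in matroid) matroid_principal_extension:
  assumes e: "e \<in> ground M"
  shows "matroid (principal_extension M e Z)"
proof
  let ?P = "principal_extension M e Z"
  have ind: "S \<in> indeps ?P \<longleftrightarrow> S - {e} \<in> indeps M \<and> (e \<in> S \<longrightarrow> \<not> Z \<subseteq> closure (S - {e}))" for S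
    by (simp add: principal_extension_def)
  show "finite (ground ?P)" using finite_ground by (simp add: principal_extension_def)
  show "I \<subseteq> ground ?P" if "I \<in> indeps ?P" for I
    using that e indeps_subset_ground[of "I - {e}"] by (auto simp: principal_extension_def)
  show "{} \<in> indeps ?P" using empty_indep by (simp add: ind)
  show "J \<in> indeps ?P" if "I \<in> indeps ?P" "J \<subseteq> I" for I J
  proof -
    have "J - {e} \<subseteq> I - {e}" using that by blast
    then show ?thesis
      using that indep_subset[of "I - {e}" "J - {e}"] closure_mono[of "J - {e}" "I - {e}"]
      by (auto simp: ind)
  qed
  show "\<exists>x\<in>J - I. insert x I \<in> indeps ?P"
    if I: "I \<in> indeps ?P" and J: "J \<in> indeps ?P" and lt: "card I < card J" for I J
  proof (rule ccontr)
    assume neg: "\<not> ?thesis"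
    define S T where "S = I - {e}" and "T = J - {e}"
    have S: "S \<in> indeps M" and T: "T \<in> indeps M" using I J by (auto simp: ind S_def T_def)
    have sub: "S \<subseteq> ground M" "T \<subseteq> ground M" using S T indeps_subset_ground by auto
    have fin: "finite S" "finite T" using S T indep_finite by auto
    have cardI: "card I = (if e \<in> I then Suc (card S) else card S)"
      using fin card_Suc_Diff1[of I e] by (auto simp: S_def)
    have cardJ: "card J = (if e \<in> J then Suc (card T) else card T)"
      using fin card_Suc_Diff1[of J e] by (auto simp: T_def)
    have notin: "x \<in> closure S" if "x \<in> T" "e \<notin> I" for x
    proof (rule ccontr)
      assume x: "x \<notin> closure S"
      then have "x \<notin> S" using subset_closure[OF sub(1)] by blast
      moreover from this have "insert x S \<in> indeps M" using x that sub S indep_insert_iff by blast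
      moreover have "insert x I - {e} = insert x S" "x \<noteq> e" using that by (auto simp: S_def T_def)
      ultimately have "insert x I \<in> indeps ?P" "x \<in> J - I" using that by (auto simp: ind S_def T_def)
      then show False using neg by blast
    qed
    have spans: "Z \<subseteq> closure (insert x S)" if "x \<in> T" "x \<notin> closure S" "e \<in> I" for x
    proof (rule ccontr)
      assume Z: "\<not> ?thesis"
      have "x \<notin> S" using subset_closure[OF sub(1)] that by blast
      moreover from this have "insert x S \<in> indeps M" using that sub S indep_insert_iff by blast
      moreover have "insert x I - {e} = insert x S" "x \<noteq> e" using that by (auto simp: S_def T_def)
      ultimately have "insert x I \<in> indeps ?P" "x \<in> J - I"
        using that Z by (auto simp: ind S_def T_def)
      then show False using neg by blast
    qed
    show False
    proof (cases "e \<in> I")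
      case False
      have TS: "T \<subseteq> closure S" using notin False by blast
      have "card T \<le> card S"
        using rank_mono[OF TS] rank_closure[OF sub(1)] rank_indep S T by simp
      then have eJ: "e \<in> J" and eq: "card T = card S"
        using lt cardI cardJ False by (auto split: if_splits)
      have "\<not> Z \<subseteq> closure T" using J eJ by (simp add: ind T_def)
      moreover have "closure S \<subseteq> closure T"
        using subset_closure_of_max[OF T S TS] eq by simp
      ultimately have "insert e I \<in> indeps ?P" using S False by (auto simp: ind S_def)
      then show False using neg False eJ by blast
    next
      case True
      have nZ: "\<not> Z \<subseteq> closure S" using I True by (simp add: ind S_def)
      have ltST: "card S < card T" using lt cardI cardJ True by (auto split: if_splits)
      then have "\<not> T \<subseteq> closure S"
        using rank_mono[of T "closure S"] rank_closure[OF sub(1)] rank_indep S T by auto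
      then obtain t where t: "t \<in> T" "t \<notin> closure S" by blast
      have Zt: "Z \<subseteq> closure (insert t S)" using spans t True by blast
      have tS: "insert t S \<in> indeps M" "t \<notin> S"
        using t sub S subset_closure[OF sub(1)] indep_insert_iff by blast+
      have Tsub: "T \<subseteq> closure (insert t S)"
      proof
        fix u assume u: "u \<in> T"
        show "u \<in> closure (insert t S)"
        proof (rule ccontr)
          assume nu: "u \<notin> closure (insert t S)"
          have "closure S \<subseteq> closure (insert t S)" by (rule closure_mono) auto
          then have "u \<notin> closure S" using nu by blast
          then have "Z \<subseteq> closure (insert u S)" using spans u True by blast
          then have "Z \<subseteq> closure S" using Zt closure_insert_Int[of S t u] nu sub t u by blast
          then show False using nZ by blast
        qed
      qed
      have "card T \<le> card (insert t S)"
        using rank_mono[OF Tsub] rank_closure[of "insert t S"] rank_indep[OF T]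
          rank_indep[OF tS(1)] indeps_subset_ground[OF tS(1)] by simp
      then have eq: "card (insert t S) = card T" using ltST tS fin by simp
      have eJ: "e \<in> J" using lt cardI cardJ True eq tS fin by (auto split: if_splits)
      have "closure (insert t S) \<subseteq> closure T"
        using subset_closure_of_max[OF T tS(1) Tsub] eq by simp
      then have "Z \<subseteq> closure T" using Zt by blast
      then show False using J eJ by (simp add: ind T_def)
    qed
  qed
qed

text \<open>Ignoring the bound \<open>n\<close>, each of \<open>C\<close> and \<open>D\<close> forms a circuit with the point \<open>f\<close>, which is then
  deleted. Counting \<open>f\<close> only once when both \<open>C\<close> and \<open>D\<close> are present is the analogue of relaxing
  the circuit-hyperplane \<open>C \<union> D\<close>; it yields a matroid only because of the interplay of \<open>n\<close> with
  \<open>small_indep\<close> below.\<close>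

definition spike_extension ::
  "'a set_system \<Rightarrow> 'a set_system \<Rightarrow> 'a \<Rightarrow> 'a set \<Rightarrow> 'a set \<Rightarrow> nat \<Rightarrow> 'a set_system" where
  "spike_extension M P f C D n = \<lparr>ground = ground M \<union> C \<union> D,
     indeps = {S. S \<subseteq> ground M \<union> C \<union> D \<and> card S \<le> n \<and> S \<inter> ground M \<in> indeps M \<and>
       (C \<subseteq> S \<or> D \<subseteq> S \<longrightarrow> insert f (S \<inter> ground M) \<in> indeps P)}\<rparr>"

text \<open>The number \<open>x\<close> will be the rank of \<open>A \<inter> B\<close>. The bound
  \<open>n\<close> is the size of \<open>C \<union> D\<close> together with a basis of that
  intersection, so that this union becomes a basis of \<open>N\<close>.\<close>

locale spike = matroid M + P: matroid P
  for M P :: "'a set_system" +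
  fixes f :: 'a and C D :: "'a set" and m x n :: nat
  assumes f_notin: "f \<notin> ground M"
    and ground_P: "ground P = insert f (ground M)"
    and restriction_P: "restriction P (ground M) = M"
    and finite_C: "finite C" and finite_D: "finite D"
    and card_C: "card C = Suc m" and card_D: "card D = Suc m"
    and disjoint: "C \<inter> D = {}" "C \<inter> ground M = {}" "D \<inter> ground M = {}"
    and small_indep: "Y \<in> indeps M \<Longrightarrow> card Y \<le> Suc x \<Longrightarrow> insert f Y \<in> indeps P"
    and n_def: "n = 2 * m + 2 + x"
begin

abbreviation "N \<equiv> spike_extension M P f C D n"

lemma indeps_M_iff: "S \<in> indeps M \<longleftrightarrow> S \<in> indeps P \<and> S \<subseteq> ground M"
  using arg_cong[OF restriction_P, of indeps] by (auto simp: restriction_def)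

lemma indeps_N_iff: "S \<in> indeps N \<longleftrightarrow> S \<subseteq> ground M \<union> C \<union> D \<and> card S \<le> n \<and> S \<inter> ground M \<in> indeps M \<and>
       (C \<subseteq> S \<or> D \<subseteq> S \<longrightarrow> insert f (S \<inter> ground M) \<in> indeps P)"
  by (simp add: spike_extension_def)

lemma ground_N: "ground N = ground M \<union> C \<union> D"
  by (simp add: spike_extension_def)

lemma card_split:
  assumes "S \<subseteq> ground M \<union> C \<union> D"
  shows "card S = card (S \<inter> ground M) + card (S \<inter> C) + card (S \<inter> D)"
proof -
  have fin: "finite (S \<inter> ground M)" "finite (S \<inter> C)" "finite (S \<inter> D)"
    using finite_ground finite_C finite_D by auto
  have "S = S \<inter> ground M \<union> S \<inter> C \<union> S \<inter> D" using assms by blast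
  also have "card \<dots> = card (S \<inter> ground M \<union> S \<inter> C) + card (S \<inter> D)"
    using fin disjoint by (intro card_Un_disjoint) auto
  also have "card (S \<inter> ground M \<union> S \<inter> C) = card (S \<inter> ground M) + card (S \<inter> C)"
    using fin disjoint by (intro card_Un_disjoint) auto
  finally show ?thesis .
qed

text \<open>The cases are whether \<open>f\<close> extends \<open>S'\<close> in \<open>P\<close>. If
  it does, \<open>C\<close> and \<open>D\<close> can be filled freely, and the question reduces to
  exchange in \<open>M\<close> or in \<open>P\<close>. If it does not, \<open>T\<close> can exceed
  \<open>S\<close> by at most one element in each of \<open>C\<close> and \<open>D\<close>, and only
  by containing that set; exceeding it in both is excluded by the bound \<open>n\<close>.\<close>

lemma augment_N:
  assumes S: "S \<in> indeps N" and T: "T \<in> indeps N" and lt: "card S < card T"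
  shows "\<exists>z\<in>T - S. insert z S \<in> indeps N"
proof (rule ccontr)
  assume neg: "\<not> ?thesis"
  let ?E = "ground M"
  define S' T' where "S' = S \<inter> ?E" and "T' = T \<inter> ?E"
  have Ssub: "S \<subseteq> ?E \<union> C \<union> D" and Tsub: "T \<subseteq> ?E \<union> C \<union> D"
    and S': "S' \<in> indeps M" and T': "T' \<in> indeps M" and Tn: "card T \<le> n"
    using S T by (auto simp: indeps_N_iff S'_def T'_def)
  have finS: "finite S" and finT: "finite T"
    using Ssub Tsub finite_ground finite_C finite_D by (auto intro: finite_subset)
  have fin': "finite S'" "finite T'" using finS finT by (auto simp: S'_def T'_def)
  have fS: "f \<notin> S'" and fT: "f \<notin> T'" using f_notin by (auto simp: S'_def T'_def)
  have cS: "card S = card S' + card (S \<inter> C) + card (S \<inter> D)"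
    and cT: "card T = card T' + card (T \<inter> C) + card (T \<inter> D)"
    using card_split Ssub Tsub by (auto simp: S'_def T'_def)
  have card_ins: "card (insert z S) \<le> n" for z
    using lt Tn finS by (simp add: card_insert_if)
  have addCD: "insert z S \<in> indeps N"
    if "z \<in> C \<union> D" "C \<subseteq> insert z S \<or> D \<subseteq> insert z S \<Longrightarrow> insert f S' \<in> indeps P" for z
  proof -
    have "insert z S \<inter> ?E = S'" using that disjoint by (auto simp: S'_def)
    then show ?thesis using that S' Ssub card_ins by (auto simp: indeps_N_iff)
  qed
  have addE: "insert z S \<in> indeps N"
    if "z \<in> ?E" "insert z S' \<in> indeps M"
      "C \<subseteq> S \<or> D \<subseteq> S \<Longrightarrow> insert f (insert z S') \<in> indeps P" for z
  proof -
    have "insert z S \<inter> ?E = insert z S'" using that by (auto simp: S'_def)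
    moreover have "C \<subseteq> insert z S \<longleftrightarrow> C \<subseteq> S" "D \<subseteq> insert z S \<longleftrightarrow> D \<subseteq> S"
      using that disjoint by auto
    ultimately show ?thesis using that Ssub card_ins by (auto simp: indeps_N_iff)
  qed
  have fullT: "insert f T' \<in> indeps P" if "C \<subseteq> T \<or> D \<subseteq> T"
    using T that by (auto simp: indeps_N_iff T'_def)
  have T'E: "T' \<subseteq> ?E" "S' \<subseteq> ?E" by (auto simp: T'_def S'_def)
  have T'P: "T' \<in> indeps P" "S' \<in> indeps P" using T' S' indeps_M_iff by auto
  show False
  proof (cases "insert f S' \<in> indeps P")
    case fS': True
    then have sub: "T \<inter> C \<subseteq> S \<inter> C" "T \<inter> D \<subseteq> S \<inter> D" using addCD neg by blast+
    have le: "card (T \<inter> C) \<le> card (S \<inter> C)" "card (T \<inter> D) \<le> card (S \<inter> D)"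
      using sub finS by (auto intro!: card_mono)
    then have lt': "card S' < card T'" using lt cS cT by simp
    \<comment> \<open>Exchange with \<open>U\<close> in \<open>P\<close> yields an element that
      extends \<open>S'\<close> together with \<open>f\<close>. If \<open>T\<close> contains neither
      \<open>C\<close> nor \<open>D\<close>, then \<open>insert f T'\<close> may be dependent, but
      the surplus of \<open>S\<close> in the set that it contains makes \<open>T'\<close> itself
      large enough.\<close>
    have "\<exists>U\<in>indeps P. U \<subseteq> insert f T' \<and> card (insert f S') < card U"
      if full: "C \<subseteq> S \<or> D \<subseteq> S"
    proof (cases "C \<subseteq> T \<or> D \<subseteq> T")
      case True
      then show ?thesis using fullT lt' fS fT fin' by (intro bexI[of _ "insert f T'"]) auto
    next
      case False
      have "card (T \<inter> C) + card (T \<inter> D) < card (S \<inter> C) + card (S \<inter> D)"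
        using full
      proof
        assume "C \<subseteq> S"
        then have "T \<inter> C \<subset> S \<inter> C" using False by blast
        then show ?thesis using le psubset_card_mono[of "S \<inter> C" "T \<inter> C"] finS by simp
      next
        assume "D \<subseteq> S"
        then have "T \<inter> D \<subset> S \<inter> D" using False by blast
        then show ?thesis using le psubset_card_mono[of "S \<inter> D" "T \<inter> D"] finS by simp
      qed
      then have "card (insert f S') < card T'" using lt cS cT fS fin' by simp
      then show ?thesis using T'P by blast
    qed
    moreover have "\<exists>U\<in>indeps M. U \<subseteq> T' \<and> card S' < card U" using T' lt' by blast
    ultimately show False
    proof (cases "C \<subseteq> S \<or> D \<subseteq> S")
      case True
      with \<open>_ \<Longrightarrow> \<exists>U\<in>indeps P. _ U\<close> obtain U where U: "U \<in> indeps P" "U \<subseteq> insert f T'" "card (insert f S') < card U"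
        by blast
      obtain z where z: "z \<in> U - insert f S'" "insert z (insert f S') \<in> indeps P"
        using P.augment[OF fS' U(1,3)] by blast
      have zT: "z \<in> T'" "z \<notin> S'" using z U by auto
      have "insert z S' \<in> indeps M"
        using P.indep_subset[OF z(2), of "insert z S'"] zT T'E by (auto simp: indeps_M_iff)
      then have "insert z S \<in> indeps N" using addE zT T'E z by (auto simp: insert_commute)
      then show False using neg zT by (auto simp: T'_def S'_def)
    next
      case False
      obtain z where z: "z \<in> T' - S'" "insert z S' \<in> indeps M" using augment[OF S' T' lt'] by blast
      then have "insert z S \<in> indeps N" using addE False T'E by blast
      then show False using neg z by (auto simp: T'_def S'_def)
    qed
  next
    case nf: False
    \<comment> \<open>A dependence of \<open>f\<close> on \<open>S'\<close> needs this many
      elements, which is just enough for the final count to reach \<open>n\<close>.\<close>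
    then have big: "card S' \<ge> x + 2" using small_indep[OF S'] by fastforce
    have nfull: "\<not> C \<subseteq> S" "\<not> D \<subseteq> S" using nf S by (auto simp: indeps_N_iff S'_def)
    have noE: "insert z S' \<notin> indeps M" if "z \<in> T' - S'" for z
      using addE[of z] that nfull neg by (auto simp: T'_def S'_def)
    have TS: "card T' \<le> card S'" using augment[OF S' T'] noE by (meson leI)
    \<comment> \<open>If some \<open>z\<close> in \<open>T \<inter> Q\<close> cannot be added to
      \<open>S\<close>, then adding it must complete \<open>C\<close> or \<open>D\<close>; so
      \<open>S\<close> contains all of \<open>Q\<close> except \<open>z\<close>.\<close>
    have compl: "card (T \<inter> Q) \<le> card (S \<inter> Q) + (if Q \<subseteq> T then 1 else 0)" "m \<le> card (S \<inter> Q) \<or> T \<inter> Q \<subseteq> S"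
      if Q: "Q = C \<or> Q = D" for Q
    proof -
      have finQ: "finite Q" "card Q = Suc m" using Q finite_C finite_D card_C card_D by auto
      have "T \<inter> Q \<subseteq> S \<or> (\<exists>z \<in> Q. S \<inter> Q = Q - {z} \<and> z \<in> T)"
      proof (rule disjCI)
        assume "\<not> (\<exists>z \<in> Q. S \<inter> Q = Q - {z} \<and> z \<in> T)"
        moreover have "\<not> (C \<subseteq> insert z S \<or> D \<subseteq> insert z S) \<Longrightarrow> z \<in> T \<Longrightarrow> z \<in> Q \<Longrightarrow> z \<in> S" for z
          using addCD[of z] neg Q by blast
        moreover have "S \<inter> Q = Q - {z}" if "C \<subseteq> insert z S \<or> D \<subseteq> insert z S" "z \<in> Q" "z \<notin> S" for z
          using that Q nfull disjoint by blast
        ultimately show "T \<inter> Q \<subseteq> S" by blast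
      qed
      then show "card (T \<inter> Q) \<le> card (S \<inter> Q) + (if Q \<subseteq> T then 1 else 0)" "m \<le> card (S \<inter> Q) \<or> T \<inter> Q \<subseteq> S"
      proof (atomize (full), elim disjE bexE conjE, goal_cases)
        case 1
        then have "card (T \<inter> Q) \<le> card (S \<inter> Q)" using finS by (intro card_mono) auto
        then show ?case using 1 by simp
      next
        case (2 z)
        then have c: "card (S \<inter> Q) = m" using finQ by simp
        show ?case
        proof (cases "Q \<subseteq> T")
          case True
          then show ?thesis using c finQ by (simp add: Int_absorb1)
        next
          case False
          then have "T \<inter> Q \<subset> Q" by blast
          then show ?thesis using c finQ psubset_card_mono[of Q "T \<inter> Q"] by simp
        qed
      qed
    qed
    note cC = compl[of C, simplified] and cD = compl[of D, simplified]
    have full: "C \<subseteq> T \<or> D \<subseteq> T"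
      using cC(1) cD(1) TS lt cS cT by (auto split: if_splits)
    \<comment> \<open>With equal sizes, \<open>insert f T'\<close> would augment \<open>S'\<close>
      in \<open>P\<close>, but neither \<open>f\<close> nor an element of \<open>T'\<close> is
      available.\<close>
    have lt': "card T' < card S'"
    proof (rule ccontr)
      assume "\<not> ?thesis"
      then have "card S' < card (insert f T')" using fT fin' by simp
      then obtain z where z: "z \<in> insert f T' - S'" "insert z S' \<in> indeps P"
        using P.augment[OF T'P(2) fullT[OF full]] by blast
      then have "z \<in> T' - S'" using nf by auto
      moreover from this have "insert z S' \<in> indeps M" using z T'E by (auto simp: indeps_M_iff)
      ultimately show False using noE by blast
    qed
    have both: "C \<subseteq> T" "D \<subseteq> T"
      using cC(1) cD(1) lt' lt cS cT by (auto split: if_splits)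
    have "m \<le> card (S \<inter> C)" "m \<le> card (S \<inter> D)" using cC(2) cD(2) both nfull by auto
    \<comment> \<open>The count is \<open>(x + 2) + m + m = n\<close>, so \<open>S\<close> already
      has full size.\<close>
    then have "n \<le> card S" using big cS n_def by simp
    then show False using lt Tn by simp
  qed
qed

lemma matroid_N: "matroid N"
proof
  show "finite (ground N)" using finite_ground finite_C finite_D by (simp add: ground_N)
  show "I \<subseteq> ground N" if "I \<in> indeps N" for I using that by (auto simp: indeps_N_iff ground_N)
  have "C \<noteq> {}" "D \<noteq> {}" using card_C card_D by auto
  then show "{} \<in> indeps N" using empty_indep by (auto simp: indeps_N_iff)
  show "J \<in> indeps N" if I: "I \<in> indeps N" and J: "J \<subseteq> I" for I J
  proof -
    have fin: "finite I"
      using I finite_ground finite_C finite_D by (auto simp: indeps_N_iff intro: finite_subset)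
    have "card J \<le> n" using I J card_mono[OF fin J] by (simp add: indeps_N_iff)
    moreover have "J \<inter> ground M \<subseteq> I \<inter> ground M" using J by blast
    moreover from this have "insert f (J \<inter> ground M) \<subseteq> insert f (I \<inter> ground M)" by blast
    ultimately show ?thesis
      using I J indep_subset[of "I \<inter> ground M" "J \<inter> ground M"]
        P.indep_subset[of "insert f (I \<inter> ground M)" "insert f (J \<inter> ground M)"]
      by (auto simp: indeps_N_iff)
  qed
qed (rule augment_N)

lemma restriction_N:
  assumes "card (ground M) \<le> n"
  shows "restriction N (ground M) = M"
proof -
  have "S \<in> indeps N \<longleftrightarrow> S \<in> indeps M" if S: "S \<subseteq> ground M" for S
  proof -
    have "C \<noteq> {}" "D \<noteq> {}" using card_C card_D by auto
    then have "\<not> C \<subseteq> S" "\<not> D \<subseteq> S" using S disjoint by blast+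
    moreover have "card S \<le> n" using card_mono[OF finite_ground S] assms by simp
    moreover have "S \<inter> ground M = S" using S by blast
    ultimately show ?thesis using S by (simp add: indeps_N_iff le_supI1)
  qed
  then have "S \<in> indeps N \<and> S \<subseteq> ground M \<longleftrightarrow> S \<in> indeps M" for S
    using indeps_subset_ground[of S] by blast
  then have "{S \<in> indeps N. S \<subseteq> ground M} = indeps M" by blast
  moreover have "ground N \<inter> ground M = ground M" by (auto simp: ground_N)
  ultimately show ?thesis by (simp add: restriction_def)
qed

text \<open>Submodularity is applied twice in the amalgam. Over \<open>A\<close> and
  \<open>B\<close>, the defect bounds the rank of \<open>insert f (X \<union> F)\<close> by
  \<open>Suc x + m\<close>, both for \<open>F = C\<close> and for \<open>F = D\<close>. The union
  and the intersection of the two resulting sets have rank at least \<open>n\<close> and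
  \<open>Suc x\<close>, and these exceed the sum of the bounds by one.\<close>

lemma no_amalgam:
  assumes AB: "A \<subseteq> ground M" "B \<subseteq> ground M"
    and defect: "rank M A + rank M B = rank M (A \<union> B) + Suc x" "rank M (A \<inter> B) = x"
    and f: "f \<in> P.closure A" "f \<in> P.closure B" "f \<notin> C" "f \<notin> D"
    and m: "card (ground M) \<le> m"
  shows "\<not> is_amalgam Q P N"
proof
  assume am: "is_amalgam Q P N"
  interpret Q: matroid Q using am by (simp add: is_amalgam_def)
  interpret N: matroid N by (rule matroid_N)
  let ?E = "ground M"
  have QP: "rank Q S = rank P S" if "S \<subseteq> insert f ?E" for S
    using rank_restriction[OF Q.matroid_axioms _ that, of P] am ground_P by (simp add: is_amalgam_def)
  have QN: "rank Q S = rank N S" if "S \<subseteq> ?E \<union> C \<union> D" for S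
    using rank_restriction[OF Q.matroid_axioms _ that, of N] am ground_N by (simp add: is_amalgam_def)
  have PM: "rank P S = rank M S" if "S \<subseteq> ?E" for S
    using rank_restriction[OF P.matroid_axioms restriction_P that] .
  have disj: "F \<inter> ?E = {}" "finite F" "card F = Suc m" if "F = C \<or> F = D" for F
    using that disjoint finite_C finite_D card_C card_D by auto
  have cap: "(S \<union> F) \<inter> ?E = S" if "S \<subseteq> ?E" "F \<subseteq> C \<union> D" for S F
    using that disjoint by blast
  have small: "card S \<le> m" if "S \<subseteq> ?E" for S using card_mono[OF finite_ground that] m by simp
  \<comment> \<open>Using all of \<open>F\<close> requires \<open>f\<close> to stay independent of
    the rest in \<open>P\<close>, and this costs one element of \<open>S\<close>, because
    \<open>f\<close> lies in the closure of \<open>S\<close>.\<close>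
  have upper: "rank N (S \<union> F) \<le> rank M S + m"
    if S: "S \<subseteq> ?E" "f \<in> P.closure S" and F: "F = C \<or> F = D" for S F
  proof -
    obtain I where I: "I \<in> indeps N" "I \<subseteq> S \<union> F" "card I = rank N (S \<union> F)" by (rule N.obtain_basis)
    have IE: "I \<inter> ?E \<in> indeps M" "I \<inter> ?E \<subseteq> S" using I cap[OF S(1), of F] F by (auto simp: indeps_N_iff)
    have finI: "finite I" using I N.indep_finite by blast
    have "I = (I \<inter> ?E) \<union> (I \<inter> F)" using I S by blast
    then have "card I = card (I \<inter> ?E) + card (I \<inter> F)"
      using card_Un_disjoint[of "I \<inter> ?E" "I \<inter> F"] disj[OF F] finI by auto
    moreover have "card (I \<inter> ?E) + card (I \<inter> F) \<le> rank M S + m"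
    proof (cases "F \<subseteq> I")
      case True
      then have "insert f (I \<inter> ?E) \<in> indeps P" using I F by (auto simp: indeps_N_iff)
      then have "card (insert f (I \<inter> ?E)) \<le> rank P (insert f S)"
        using IE by (intro P.card_indep_le_rank) auto
      also have "\<dots> = rank M S" using S PM by (simp add: P.closure_def)
      finally show ?thesis using True disj[OF F] finI f_notin by (simp add: Int_absorb1)
    next
      case False
      then have "I \<inter> F \<subset> F" by blast
      then have "card (I \<inter> F) \<le> m" using psubset_card_mono[of F "I \<inter> F"] disj[OF F] by simp
      then show ?thesis using card_indep_le_rank[OF IE] by simp
    qed
    ultimately show ?thesis using I by simp
  qed
  \<comment> \<open>A basis of \<open>S\<close> with \<open>m\<close> elements of \<open>F\<close>
    completes neither \<open>C\<close> nor \<open>D\<close>. It respects the bound \<open>n\<close>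
    because \<open>m\<close> is at least the size of the ground set of \<open>M\<close>.\<close>
  have lower: "rank M S + m \<le> rank N (S \<union> F)" if S: "S \<subseteq> ?E" and F: "F = C \<or> F = D" for S F
  proof -
    obtain J where J: "J \<in> indeps M" "J \<subseteq> S" "card J = rank M S" by (rule obtain_basis)
    obtain F0 where F0: "F0 \<subseteq> F" "card F0 = m" "finite F0"
      using obtain_subset_with_card_n[of m F] disj[OF F] by auto
    have JE: "J \<subseteq> ?E" using J S by blast
    have c: "card (J \<union> F0) = card J + m"
      using F0 JE disj[OF F] J indep_finite by (subst card_Un_disjoint) auto
    have "\<not> C \<subseteq> J \<union> F0" "\<not> D \<subseteq> J \<union> F0"
    proof -
      have "\<not> F \<subseteq> F0" using F0 disj[OF F] card_mono[of F0 F] by auto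
      moreover have "C \<noteq> {}" "D \<noteq> {}" using card_C card_D by auto
      ultimately show "\<not> C \<subseteq> J \<union> F0" "\<not> D \<subseteq> J \<union> F0" using F F0 JE disjoint by blast+
    qed
    moreover have "(J \<union> F0) \<inter> ?E = J" using cap[OF JE] F F0 by blast
    moreover have "card (J \<union> F0) \<le> n" using c small[OF JE] n_def by simp
    ultimately have "J \<union> F0 \<in> indeps N" using J JE F0 F by (auto simp: indeps_N_iff)
    then show ?thesis using N.card_indep_le_rank[of "J \<union> F0" "S \<union> F"] c J F0 by auto
  qed
  define X where "X = A \<inter> B"
  have XE: "X \<subseteq> ?E" using AB by (auto simp: X_def)
  obtain X' where X': "X' \<in> indeps M" "X' \<subseteq> X" "card X' = x"
  proof -
    obtain Y where "Y \<in> indeps M" "Y \<subseteq> X" "card Y = rank M X" by (rule obtain_basis)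
    then show ?thesis using that[of Y] defect by (simp add: X_def)
  qed
  have fX': "insert f X' \<in> indeps P" using small_indep X' by simp
  have Xf: "Suc x \<le> rank Q (insert f X)"
  proof -
    have "f \<notin> X'" using X' XE f_notin by blast
    then have "Suc x = card (insert f X')" using X' indep_finite by simp
    also have "\<dots> \<le> rank P (insert f X)" using fX' X' by (intro P.card_indep_le_rank) auto
    also have "\<dots> = rank Q (insert f X)" using QP[OF insert_mono[OF XE]] by simp
    finally show ?thesis .
  qed
  \<comment> \<open>Here the relaxation enters: \<open>C\<close> and \<open>D\<close> are both
    complete, but together they require only that the single point \<open>f\<close> be independent
    of \<open>X'\<close>.\<close>
  have XCD: "n \<le> rank Q (X \<union> C \<union> D)"
  proof -
    have X'E: "X' \<subseteq> ?E" using X' XE by blast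
    have "card (X' \<union> (C \<union> D)) = x + (Suc m + Suc m)"
    proof -
      have "card (C \<union> D) = Suc m + Suc m"
        using disjoint finite_C finite_D card_C card_D by (simp add: card_Un_disjoint)
      moreover have "X' \<inter> (C \<union> D) = {}" using X'E disjoint by blast
      ultimately show ?thesis
        using X' indep_finite finite_C finite_D by (simp add: card_Un_disjoint)
    qed
    then have c: "card (X' \<union> (C \<union> D)) = n" by (simp add: n_def)
    then have "X' \<union> (C \<union> D) \<in> indeps N"
      using fX' X' cap[OF X'E, of "C \<union> D"] X'E by (auto simp: indeps_N_iff)
    then have "n \<le> rank N (X \<union> C \<union> D)"
      using c N.card_indep_le_rank[of "X' \<union> (C \<union> D)" "X \<union> C \<union> D"] X' by auto
    moreover have "X \<union> C \<union> D \<subseteq> ?E \<union> C \<union> D" using XE by blast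
    ultimately show ?thesis using QN by simp
  qed
  have key: "rank Q (insert f (X \<union> F)) \<le> Suc x + m" if F: "F = C \<or> F = D" for F
  proof -
    have *: "rank Q (insert f (S \<union> F)) = rank N (S \<union> F)" if S: "S \<subseteq> ?E" "f \<in> P.closure S" for S
    proof -
      have "rank P (insert f S) = rank P S" using S by (simp add: P.closure_def)
      moreover have "S \<subseteq> insert f ?E" "insert f S \<subseteq> insert f ?E" using S by auto
      ultimately have "rank Q (insert f S) = rank Q S" using QP[of S] QP[of "insert f S"] by simp
      then have "rank Q (insert f (S \<union> F)) = rank Q (S \<union> F)"
        by (rule Q.rank_insert_absorb_mono) auto
      then show ?thesis using QN[of "S \<union> F"] S F by auto
    qed
    let ?A = "insert f (A \<union> F)" and ?B = "insert f (B \<union> F)"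
    have "rank Q (?A \<union> ?B) + rank Q (?A \<inter> ?B) \<le> rank Q ?A + rank Q ?B"
      by (rule Q.rank_submodular)
    moreover have "rank Q ?A \<le> rank M A + m" using *[OF AB(1) f(1)] upper[OF AB(1) f(1) F] by simp
    moreover have "rank Q ?B \<le> rank M B + m" using *[OF AB(2) f(2)] upper[OF AB(2) f(2) F] by simp
    moreover have "rank M (A \<union> B) + m \<le> rank Q (?A \<union> ?B)"
    proof -
      have "rank M (A \<union> B) + m \<le> rank N (A \<union> B \<union> F)" using lower[of "A \<union> B" F] AB F by auto
      also have "\<dots> = rank Q (A \<union> B \<union> F)" using QN[of "A \<union> B \<union> F"] AB F by (metis Un_subset_iff le_supI1 sup_ge1 sup_ge2)
      also have "\<dots> \<le> rank Q (?A \<union> ?B)" by (intro Q.rank_mono) auto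
      finally show ?thesis .
    qed
    moreover have "?A \<inter> ?B = insert f (X \<union> F)" by (auto simp: X_def)
    ultimately show ?thesis using defect by simp
  qed
  let ?C = "insert f (X \<union> C)" and ?D = "insert f (X \<union> D)"
  have "rank Q (?C \<union> ?D) + rank Q (?C \<inter> ?D) \<le> rank Q ?C + rank Q ?D"
    by (rule Q.rank_submodular)
  moreover have "?C \<inter> ?D = insert f X" using disjoint by auto
  moreover have "rank Q (X \<union> C \<union> D) \<le> rank Q (?C \<union> ?D)" by (intro Q.rank_mono) auto
  ultimately show False using key[of C] key[of D] XCD Xf n_def by simp
qed

end

text \<open>The extension \<open>P\<close> is played against a spike over the same \<open>f\<close>.
  An infinite type leaves room for \<open>C\<close> and \<open>D\<close> outside
  \<open>insert f (ground M)\<close>, and the two extensions meet exactly in \<open>M\<close>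
  because \<open>f\<close> is not an element of the spike.\<close>

lemma not_sticky_of_extension:
  fixes M :: "'a::infinite set_system"
  assumes "matroid M" "matroid P" "f \<notin> ground M" "ground P = insert f (ground M)"
    and restr: "restriction P (ground M) = M"
    and small: "\<And>Y. Y \<in> indeps M \<Longrightarrow> card Y \<le> Suc (rank M (A \<inter> B)) \<Longrightarrow> insert f Y \<in> indeps P"
    and AB: "A \<subseteq> ground M" "B \<subseteq> ground M"
    and defect: "rank M A + rank M B = rank M (A \<union> B) + Suc (rank M (A \<inter> B))"
    and f: "f \<in> matroid.closure P A" "f \<in> matroid.closure P B"
  shows "\<not> sticky M"
proof
  assume sticky: "sticky M"
  interpret matroid M by fact
  define m where "m = card (ground M)"
  define n where "n = 2 * m + 2 + rank M (A \<inter> B)"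
  have "infinite (- insert f (ground M))"
    using finite_ground infinite_UNIV by (simp add: Compl_eq_Diff_UNIV)
  from infinite_arbitrarily_large[OF this, of "Suc m"]
  obtain C where C: "C \<subseteq> - insert f (ground M)" "finite C" "card C = Suc m" by blast
  have "infinite (- (insert f (ground M) \<union> C))"
    using finite_ground infinite_UNIV C by (simp add: Compl_eq_Diff_UNIV)
  from infinite_arbitrarily_large[OF this, of "Suc m"]
  obtain D where D: "D \<subseteq> - (insert f (ground M) \<union> C)" "finite D" "card D = Suc m" by blast
  interpret spike M P f C D m "rank M (A \<inter> B)" n
    by (intro spike.intro spike_axioms.intro) (use assms C D n_def in auto)
  have "restriction N (ground M) = M" by (rule restriction_N) (simp add: n_def m_def)
  moreover have "ground P \<inter> ground N = ground M" using C D ground_N ground_P by auto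
  ultimately obtain Q where "is_amalgam Q P N"
    using sticky[unfolded sticky_def, rule_format, of P N] matroid_N assms(2) restr by auto
  moreover have "f \<notin> C" "f \<notin> D" using C D by auto
  ultimately show False using no_amalgam[of A B Q] AB defect f m_def by simp
qed

section \<open>Matroids from linear closure operators\<close>

context matroid begin

lemma closure_basis:
  assumes "B \<in> indeps M" "B \<subseteq> S" "card B = rank M S" "S \<subseteq> ground M"
  shows "closure B = closure S"
proof
  show "closure B \<subseteq> closure S" using assms by (intro closure_mono)
  have "rank M (insert s B) = rank M B" if "s \<in> S" for s
    using that assms rank_mono[of "insert s B" S] rank_insert_ge[of B s] rank_indep[of B] by auto
  then have "S \<subseteq> closure B" using assms by (auto simp: closure_def)
  then show "closure S \<subseteq> closure B" using assms by (intro closure_subset_closure) auto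
qed

lemma modular_pair_iff:
  "modular_pair M A B \<longleftrightarrow> rank M A + rank M B \<le> rank M (A \<union> B) + rank M (A \<inter> B)"
  using rank_submodular[of A B] by (auto simp: modular_pair_def)

lemma modular_pair_subset: "A \<subseteq> B \<Longrightarrow> modular_pair M A B" "B \<subseteq> A \<Longrightarrow> modular_pair M A B"
  by (auto simp: modular_pair_def Un_absorb1 Un_absorb2 Int_absorb1 Int_absorb2)

text \<open>Among the nonmodular pairs of flats, one with \<open>B\<close> of least rank is taken,
  and \<open>B\<close> is shrunk to a flat \<open>B'\<close> of rank one less that still contains
  \<open>A \<inter> B\<close>. The pair of \<open>A\<close> and \<open>B'\<close> is modular by
  minimality, and regaining the lost rank creates a defect of at most one.\<close>

lemma obtain_defect_one:
  assumes "\<not> modular M"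
  obtains A B where "flat M A" "flat M B"
    "rank M A + rank M B = rank M (A \<union> B) + Suc (rank M (A \<inter> B))"
proof -
  define bad where "bad p = (flat M (fst p) \<and> flat M (snd p) \<and> \<not> modular_pair M (fst p) (snd p))" for p
  have "\<exists>p. bad p" using assms by (auto simp: modular_def modular_flat_def bad_def)
  then obtain p where p: "bad p" "\<And>q. bad q \<Longrightarrow> rank M (snd p) \<le> rank M (snd q)"
    using exists_least_iff[of "\<lambda>k. \<exists>p. bad p \<and> rank M (snd p) = k"] by (metis not_less)
  define A B where "A = fst p" and "B = snd p"
  have A: "flat M A" and B: "flat M B" and nmod: "\<not> modular_pair M A B"
    using p(1) by (auto simp: bad_def A_def B_def)
  have sub: "A \<subseteq> ground M" "B \<subseteq> ground M" using A B by (auto simp: flat_def)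
  obtain I where I: "I \<in> indeps M" "I \<subseteq> A \<inter> B" "card I = rank M (A \<inter> B)" by (rule obtain_basis)
  have "I \<subseteq> B" using I by blast
  with I(1) obtain K where K: "I \<subseteq> K" "K \<in> indeps M" "K \<subseteq> B" "card K = rank M B"
    by (rule extend_to_basis)
  \<comment> \<open>If \<open>A \<inter> B\<close> spanned \<open>B\<close>, then \<open>B\<close>
    would lie in the flat \<open>A\<close>, and nested pairs are modular.\<close>
  have "K \<noteq> I"
  proof
    assume "K = I"
    then have "closure B = closure (A \<inter> B)"
      using closure_basis[OF K(2-4) sub(2)] closure_basis[OF I] sub by auto
    moreover have "closure (A \<inter> B) \<subseteq> closure A" by (rule closure_mono) auto
    ultimately have "B \<subseteq> A" using A B by (simp add: flat_iff)
    then show False using nmod modular_pair_subset by blast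
  qed
  then obtain b where b: "b \<in> K" "b \<notin> I" using K by blast
  define B' where "B' = closure (K - {b})"
  have Kg: "K \<subseteq> ground M" "K - {b} \<subseteq> ground M" using K sub by auto
  have Kb: "K - {b} \<in> indeps M" using K indep_subset by blast
  have finK: "finite K" using K indep_finite by blast
  have B': "flat M B'" using flat_closure[OF Kg(2)] by (simp add: B'_def)
  have rB': "rank M B = Suc (rank M B')"
    using rank_closure[OF Kg(2)] rank_indep[OF Kb] K b finK card_Suc_Diff1[of K b] by (simp add: B'_def)
  have "closure (K - {b}) \<subseteq> closure B" using K by (intro closure_mono) auto
  then have B'B: "B' \<subseteq> B" using B by (simp add: B'_def flat_iff)
  have "closure I \<subseteq> closure (K - {b})" using K b by (intro closure_mono) auto
  moreover have "A \<inter> B \<subseteq> closure I"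
    using closure_basis[OF I] subset_closure[of "A \<inter> B"] sub by auto
  ultimately have ABB': "A \<inter> B' = A \<inter> B" using B'B by (auto simp: B'_def)
  have "\<not> bad (A, B')" using p(2)[of "(A, B')"] rB' by (auto simp: B_def)
  then have "modular_pair M A B'" using A B' by (simp add: bad_def)
  then have "rank M A + rank M B' \<le> rank M (A \<union> B) + rank M (A \<inter> B)"
    using rank_mono[OF Un_mono[OF order_refl B'B], of A] ABB' by (simp add: modular_pair_def)
  moreover have "rank M (A \<union> B) + rank M (A \<inter> B) < rank M A + rank M B"
    using nmod by (simp add: modular_pair_iff)
  ultimately have "rank M A + rank M B = rank M (A \<union> B) + Suc (rank M (A \<inter> B))" using rB' by simp
  then show ?thesis using that A B by blast
qed

end

text \<open>Two spans are instances: the span over a field, and the span in \<open>R\<^sup>n\<close>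
  modulo an ideal, where the closure of the empty set need not be trivial. The axioms up to exchange
  yield a matroid; closure under differences and the splitting of a union are the linear features
  from which modularity is derived.\<close>

locale linear_closure =
  fixes cl :: "'v::ab_group_add set \<Rightarrow> 'v set" and V :: "'v set"
  assumes subset_cl: "S \<subseteq> V \<Longrightarrow> S \<subseteq> cl S"
    and cl_subset: "S \<subseteq> V \<Longrightarrow> cl S \<subseteq> V"
    and cl_mono: "S \<subseteq> T \<Longrightarrow> T \<subseteq> V \<Longrightarrow> cl S \<subseteq> cl T"
    and cl_least: "S \<subseteq> V \<Longrightarrow> T \<subseteq> cl S \<Longrightarrow> cl T \<subseteq> cl S"
    and cl_exchange: "S \<subseteq> V \<Longrightarrow> v \<in> V \<Longrightarrow> w \<in> cl (insert v S) \<Longrightarrow> w \<notin> cl S \<Longrightarrow> v \<in> cl (insert w S)"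
    and cl_diff: "S \<subseteq> V \<Longrightarrow> v \<in> cl S \<Longrightarrow> w \<in> cl S \<Longrightarrow> v - w \<in> cl S"
    and cl_Un: "S \<subseteq> V \<Longrightarrow> T \<subseteq> V \<Longrightarrow> u \<in> cl (S \<union> T) \<Longrightarrow> \<exists>v\<in>cl S. \<exists>w\<in>cl T. u = v + w"
begin

text \<open>Independence is a condition on the indexed family, so two elements that share a vector
  are dependent without a separate injectivity clause.\<close>

definition linear_matroid :: "('e \<Rightarrow> 'v) \<Rightarrow> 'e set \<Rightarrow> 'e set_system" where
  "linear_matroid \<pi> E = \<lparr>ground = E, indeps = {I. I \<subseteq> E \<and> (\<forall>x\<in>I. \<pi> x \<notin> cl (\<pi> ` (I - {x})))}\<rparr>"

lemma cl_add: "S \<subseteq> V \<Longrightarrow> v \<in> cl S \<Longrightarrow> w \<in> cl S \<Longrightarrow> v + w \<in> cl S"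
  using cl_diff[of S w w] cl_diff[of S "w - w" w] cl_diff[of S v "w - w - w"] by simp

end

locale linear_family = linear_closure cl V
  for cl :: "'v::ab_group_add set \<Rightarrow> 'v set" and V +
  fixes \<pi> :: "'e \<Rightarrow> 'v" and E :: "'e set"
  assumes finite_E: "finite E" and in_V: "x \<in> E \<Longrightarrow> \<pi> x \<in> V"
begin

abbreviation "L \<equiv> linear_matroid \<pi> E"

lemma ground_L [simp]: "ground L = E"
  by (simp add: linear_matroid_def)

lemma indeps_L_iff: "I \<in> indeps L \<longleftrightarrow> I \<subseteq> E \<and> (\<forall>x\<in>I. \<pi> x \<notin> cl (\<pi> ` (I - {x})))"
  by (simp add: linear_matroid_def)

lemma image_subset_V: "S \<subseteq> E \<Longrightarrow> \<pi> ` S \<subseteq> V"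
  using in_V by auto

lemma cl_image_mono: "S \<subseteq> T \<Longrightarrow> T \<subseteq> E \<Longrightarrow> cl (\<pi> ` S) \<subseteq> cl (\<pi> ` T)"
  by (intro cl_mono image_subset_V) auto

lemma indep_L_insert:
  assumes I: "I \<in> indeps L" and x: "x \<in> E" "\<pi> x \<notin> cl (\<pi> ` I)"
  shows "insert x I \<in> indeps L"
  unfolding indeps_L_iff
proof (intro conjI ballI)
  have IE: "I \<subseteq> E" using I by (simp add: indeps_L_iff)
  then show "insert x I \<subseteq> E" using x by simp
  have xI: "x \<notin> I" using x subset_cl[OF image_subset_V[OF IE]] by blast
  fix y assume y: "y \<in> insert x I"
  show "\<pi> y \<notin> cl (\<pi> ` (insert x I - {y}))"
  proof (cases "y = x")
    case True
    then show ?thesis using x xI by simp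
  next
    case False
    then have "y \<in> I" using y by simp
    show ?thesis
    proof
      assume "\<pi> y \<in> cl (\<pi> ` (insert x I - {y}))"
      moreover have "insert x I - {y} = insert x (I - {y})" using False by auto
      ultimately have "\<pi> y \<in> cl (insert (\<pi> x) (\<pi> ` (I - {y})))" by simp
      moreover have "\<pi> y \<notin> cl (\<pi> ` (I - {y}))" using I \<open>y \<in> I\<close> by (simp add: indeps_L_iff)
      ultimately have "\<pi> x \<in> cl (insert (\<pi> y) (\<pi> ` (I - {y})))"
        using cl_exchange[of "\<pi> ` (I - {y})" "\<pi> x" "\<pi> y"] image_subset_V[of "I - {y}"] IE x in_V by blast
      moreover have "insert (\<pi> y) (\<pi> ` (I - {y})) = \<pi> ` I" using \<open>y \<in> I\<close> by blast
      ultimately show False using x by simp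
    qed
  qed
qed

text \<open>If \<open>y\<close> in \<open>J\<close> is outside \<open>I\<close>, then
  \<open>I\<close> cannot lie in the closure of the rest of \<open>J\<close>, since that closure
  would then contain \<open>y\<close>. An element of \<open>I\<close> outside it replaces
  \<open>y\<close>, and fewer elements of \<open>J\<close> remain outside \<open>I\<close>.\<close>

lemma steinitz:
  assumes "J \<in> indeps L" "I \<subseteq> E" "\<pi> ` J \<subseteq> cl (\<pi> ` I)"
  shows "card J \<le> card I"
  using assms
proof (induction "card (J - I)" arbitrary: J rule: less_induct)
  case less
  have J: "J \<subseteq> E" "finite J" and finI: "finite I"
    using less.prems finite_E finite_subset by (auto simp: indeps_L_iff)
  show ?case
  proof (cases "J \<subseteq> I")
    case True
    then show ?thesis using finI card_mono by blast
  next
    case False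
    then obtain y where y: "y \<in> J" "y \<notin> I" by blast
    let ?J = "J - {y}"
    have JV: "\<pi> ` ?J \<subseteq> V" using J by (intro image_subset_V) auto
    have "\<not> \<pi> ` I \<subseteq> cl (\<pi> ` ?J)"
    proof
      assume "\<pi> ` I \<subseteq> cl (\<pi> ` ?J)"
      then have "cl (\<pi> ` I) \<subseteq> cl (\<pi> ` ?J)" by (rule cl_least[OF JV])
      moreover have "\<pi> y \<in> cl (\<pi> ` I)" using less.prems(3) y(1) by auto
      ultimately have "\<pi> y \<in> cl (\<pi> ` ?J)" by (rule subsetD)
      moreover have "\<pi> y \<notin> cl (\<pi> ` ?J)" using less.prems(1) y(1) unfolding indeps_L_iff by simp
      ultimately show False by simp
    qed
    then obtain x where x: "x \<in> I" "\<pi> x \<notin> cl (\<pi> ` ?J)" by blast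
    have "?J \<in> indeps L"
      unfolding indeps_L_iff
    proof (intro conjI ballI)
      fix z assume z: "z \<in> ?J"
      have "cl (\<pi> ` (?J - {z})) \<subseteq> cl (\<pi> ` (J - {z}))" using J by (intro cl_image_mono) auto
      then show "\<pi> z \<notin> cl (\<pi> ` (?J - {z}))" using z less.prems by (auto simp: indeps_L_iff)
    qed (use J in auto)
    then have ind: "insert x ?J \<in> indeps L" using x less.prems by (intro indep_L_insert) auto
    have xJ: "x \<notin> ?J" using x subset_cl[OF JV] by blast
    have c: "card (insert x ?J) = card J" using xJ J y by (simp add: card_Suc_Diff1 del: card_Diff_insert)
    have "insert x ?J - I = (J - I) - {y}" using x by auto
    then have "card (insert x ?J - I) < card (J - I)"
      using y J by (simp add: card_Diff1_less del: card_Diff_insert)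
    moreover have "\<pi> ` insert x ?J \<subseteq> cl (\<pi> ` I)"
      using less.prems x subset_cl[OF image_subset_V[OF less.prems(2)]] by blast
    ultimately show ?thesis using less.hyps[of "insert x ?J"] ind less.prems(2) c by simp
  qed
qed

lemma matroid_L: "matroid L"
proof
  show "finite (ground L)" by (simp add: finite_E)
  show "I \<subseteq> ground L" if "I \<in> indeps L" for I using that by (simp add: indeps_L_iff)
  show "{} \<in> indeps L" by (simp add: indeps_L_iff)
  show "J \<in> indeps L" if I: "I \<in> indeps L" "J \<subseteq> I" for I J
    unfolding indeps_L_iff
  proof (intro conjI ballI)
    fix x assume x: "x \<in> J"
    have "cl (\<pi> ` (J - {x})) \<subseteq> cl (\<pi> ` (I - {x}))"
      using I by (intro cl_image_mono) (auto simp: indeps_L_iff)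
    then show "\<pi> x \<notin> cl (\<pi> ` (J - {x}))" using I x by (auto simp: indeps_L_iff)
  qed (use I in \<open>auto simp: indeps_L_iff\<close>)
  show "\<exists>x\<in>J - I. insert x I \<in> indeps L"
    if I: "I \<in> indeps L" and J: "J \<in> indeps L" and lt: "card I < card J" for I J
  proof (rule ccontr)
    assume neg: "\<not> ?thesis"
    have sub: "I \<subseteq> E" "J \<subseteq> E" using I J by (auto simp: indeps_L_iff)
    have "\<pi> x \<in> cl (\<pi> ` I)" if "x \<in> J" for x
    proof (cases "x \<in> I")
      case True
      then show ?thesis using subset_cl[OF image_subset_V[OF sub(1)]] by blast
    next
      case False
      then show ?thesis using neg that indep_L_insert[OF I] sub by blast
    qed
    then have "card J \<le> card I" using steinitz[OF J sub(1)] by blast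
    then show False using lt by simp
  qed
qed

sublocale L: matroid L by (rule matroid_L)

lemma closure_L:
  assumes S: "S \<subseteq> E"
  shows "L.closure S = {x \<in> E. \<pi> x \<in> cl (\<pi> ` S)}"
proof -
  obtain B where B: "B \<in> indeps L" "B \<subseteq> S" "card B = rank L S" by (rule L.obtain_basis)
  have BE: "B \<subseteq> E" using B S by blast
  note BV = image_subset_V[OF BE]
  have SB: "\<pi> ` S \<subseteq> cl (\<pi> ` B)"
  proof (rule ccontr)
    assume "\<not> ?thesis"
    then obtain x where x: "x \<in> S" "\<pi> x \<notin> cl (\<pi> ` B)" by blast
    then have "insert x B \<in> indeps L" "x \<notin> B"
      using B S indep_L_insert subset_cl[OF BV] by blast+
    then have "Suc (card B) \<le> rank L S"
      using L.card_indep_le_rank[of "insert x B" S] B x L.indep_finite[OF B(1)] by simp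
    then show False using B by simp
  qed
  have eq: "cl (\<pi> ` S) = cl (\<pi> ` B)"
    using cl_least[OF BV SB] cl_image_mono[OF B(2) S] by blast
  have "rank L (insert x S) = rank L S \<longleftrightarrow> \<pi> x \<in> cl (\<pi> ` B)" if x: "x \<in> E" for x
  proof
    assume rk: "rank L (insert x S) = rank L S"
    show "\<pi> x \<in> cl (\<pi> ` B)"
    proof (rule ccontr)
      assume nx: "\<pi> x \<notin> cl (\<pi> ` B)"
      then have "insert x B \<in> indeps L" "x \<notin> B"
        using B x indep_L_insert subset_cl[OF BV] by blast+
      then have "Suc (card B) \<le> rank L (insert x S)"
        using L.card_indep_le_rank[of "insert x B" "insert x S"] B L.indep_finite[OF B(1)]
        by (simp add: subset_insertI2)
      then show False using B rk by simp
    qed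
  next
    assume x: "\<pi> x \<in> cl (\<pi> ` B)"
    obtain J where J: "J \<in> indeps L" "J \<subseteq> insert x S" "card J = rank L (insert x S)"
      by (rule L.obtain_basis)
    have "\<pi> ` J \<subseteq> cl (\<pi> ` B)" using J SB x by blast
    then have "card J \<le> card B" by (rule steinitz[OF J(1) BE])
    then show "rank L (insert x S) = rank L S" using J B L.rank_insert_ge[of S x] by simp
  qed
  then show ?thesis using eq by (auto simp: L.closure_def)
qed

text \<open>A basis \<open>I\<close> of \<open>A\<close> is extended by \<open>J\<close> to a basis
  of \<open>A \<union> B\<close>. If \<open>b\<close> in \<open>B\<close> is \<open>v + w\<close>
  with \<open>v\<close> from \<open>I\<close> and \<open>w\<close> from \<open>J\<close>, then
  \<open>v = b - w\<close> lies in both closures, hence in that of \<open>A \<inter> B\<close>. So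
  \<open>A \<inter> B \<union> J\<close> spans \<open>B\<close>, and counting finishes. Read
  contrapositively, a nonmodular pair supplies a vector in both closures but outside that of the
  intersection.\<close>

lemma modular_pair_L:
  assumes AB: "A \<subseteq> E" "B \<subseteq> E" and Int: "cl (\<pi> ` A) \<inter> cl (\<pi> ` B) \<subseteq> cl (\<pi> ` (A \<inter> B))"
  shows "modular_pair L A B"
proof -
  obtain I where I: "I \<in> indeps L" "I \<subseteq> A" "card I = rank L A" by (rule L.obtain_basis)
  have "I \<subseteq> A \<union> B" using I by blast
  with I(1) obtain K where K: "I \<subseteq> K" "K \<in> indeps L" "K \<subseteq> A \<union> B" "card K = rank L (A \<union> B)"
    by (rule L.extend_to_basis)
  have finK: "finite K" using K L.indep_finite by blast
  have "card (K \<inter> A) \<le> card I"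
    using L.card_indep_le_rank[of "K \<inter> A" A] L.indep_subset[OF K(2), of "K \<inter> A"] I by simp
  moreover have "I \<subseteq> K \<inter> A" using I K by blast
  ultimately have KA: "K \<inter> A = I" using card_seteq[of "K \<inter> A" I] finK by simp
  define J where "J = K - I"
  have J: "J \<subseteq> B" "K = I \<union> J" using K KA by (auto simp: J_def)
  have cJ: "card K = card I + card J" 
    using finK K card_mono[of K I] finite_subset[OF K(1) finK] by (simp add: J_def card_Diff_subset)
  have sub: "I \<subseteq> E" "J \<subseteq> E" "K \<subseteq> E" "A \<union> B \<subseteq> E" "A \<inter> B \<union> J \<subseteq> E" "A \<inter> B \<subseteq> E" using AB I J K by auto
  have "\<pi> b \<in> cl (\<pi> ` (A \<inter> B \<union> J))" if b: "b \<in> B" for b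
  proof -
    have "b \<in> L.closure (A \<union> B)" using b AB L.subset_closure[of "A \<union> B"] by auto
    then have "b \<in> L.closure K" using L.closure_basis[OF K(2-4)] sub by simp
    then have "\<pi> b \<in> cl (\<pi> ` I \<union> \<pi> ` J)" using closure_L[OF sub(3)] J by (simp add: image_Un)
    then obtain v w where vw: "v \<in> cl (\<pi> ` I)" "w \<in> cl (\<pi> ` J)" "\<pi> b = v + w"
      using cl_Un[OF image_subset_V[OF sub(1)] image_subset_V[OF sub(2)]] by blast
    have "w \<in> cl (\<pi> ` B)" using vw cl_image_mono[OF J(1) AB(2)] by blast
    moreover have "\<pi> b \<in> cl (\<pi> ` B)" using b subset_cl[OF image_subset_V[OF AB(2)]] by blast
    ultimately have "\<pi> b - w \<in> cl (\<pi> ` B)" using cl_diff[OF image_subset_V[OF AB(2)]] by simp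
    then have "v \<in> cl (\<pi> ` B)" using vw by simp
    moreover have "v \<in> cl (\<pi> ` A)" using vw cl_image_mono[OF I(2) AB(1)] by blast
    ultimately have "v \<in> cl (\<pi> ` (A \<inter> B))" using Int by blast
    then have "v \<in> cl (\<pi> ` (A \<inter> B \<union> J))" using cl_image_mono[of "A \<inter> B" "A \<inter> B \<union> J"] sub by auto
    moreover have "w \<in> cl (\<pi> ` (A \<inter> B \<union> J))" using vw cl_image_mono[of J "A \<inter> B \<union> J"] sub by auto
    ultimately show ?thesis using cl_add[OF image_subset_V[OF sub(5)]] vw by simp
  qed
  then have "B \<subseteq> L.closure (A \<inter> B \<union> J)" using closure_L[OF sub(5)] AB by auto
  then have "rank L B \<le> rank L (A \<inter> B \<union> J)"
    using L.rank_mono[of B "L.closure (A \<inter> B \<union> J)"] L.rank_closure[of "A \<inter> B \<union> J"] sub by simp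
  also have "\<dots> \<le> rank L (A \<inter> B) + card J"
    using L.rank_submodular[of "A \<inter> B" J] L.rank_le_card[of J] finite_subset[OF sub(2) finite_E] by simp
  finally show ?thesis using I K cJ by (simp add: L.modular_pair_iff)
qed

text \<open>A vector common to the closures of two flats is represented by an element of
  \<open>E\<close>, which then belongs to both flats. Representation only up to \<open>cl {}\<close>
  suffices, so one element per residue class of vectors is enough.\<close>

lemma modular_L:
  assumes full: "\<And>v. v \<in> V \<Longrightarrow> \<exists>x\<in>E. v - \<pi> x \<in> cl {}"
  shows "modular L"
  unfolding modular_def modular_flat_def
proof (intro allI impI conjI)
  fix A B assume A: "flat L A" and B: "flat L B"
  have sub: "A \<subseteq> E" "B \<subseteq> E" "A \<inter> B \<subseteq> E" using A B by (auto simp: flat_def)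
  have "v \<in> cl (\<pi> ` (A \<inter> B))" if v: "v \<in> cl (\<pi> ` A)" "v \<in> cl (\<pi> ` B)" for v
  proof -
    have "v \<in> V" using v(1) cl_subset[OF image_subset_V[OF sub(1)]] by (rule rev_subsetD)
    then obtain x where x: "x \<in> E" "v - \<pi> x \<in> cl {}" using full by blast
    have z: "v - \<pi> x \<in> cl (\<pi> ` S)" if "S \<subseteq> E" for S
      using x cl_image_mono[of "{}" S] that by auto
    have "x \<in> L.closure S" if "v \<in> cl (\<pi> ` S)" "S \<subseteq> E" for S
      using cl_diff[OF image_subset_V[OF that(2)] that(1) z[OF that(2)]] closure_L[OF that(2)] x by simp
    then have "x \<in> A \<inter> B" using v sub A B by (auto simp: L.flat_iff)
    then have "\<pi> x \<in> cl (\<pi> ` (A \<inter> B))" using subset_cl[OF image_subset_V[OF sub(3)]] by blast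
    then show ?thesis using cl_add[OF image_subset_V[OF sub(3)], of "v - \<pi> x" "\<pi> x"] z[OF sub(3)] by simp
  qed
  then show "modular_pair L A B" using sub by (intro modular_pair_L) auto
qed

end

section \<open>Sticky realizable matroids\<close>

text \<open>The label \<open>f\<close> is used twice. It is attached to a vector \<open>e\<close> in
  both closures but not in that of \<open>A \<inter> B\<close>, and then moved to a generic position
  on the flat spanned by \<open>A \<inter> B\<close> and \<open>e\<close>. That flat lies in the
  closures of \<open>A\<close> and of \<open>B\<close>, so \<open>f\<close> stays in both.\<close>

lemma (in linear_family) extension_of_defect_one:
  fixes f :: 'e
  assumes f: "f \<notin> E" and A: "flat L A" and B: "flat L B"
    and defect: "rank L A + rank L B = rank L (A \<union> B) + Suc (rank L (A \<inter> B))"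
  obtains P where "matroid P" "ground P = insert f E" "restriction P E = L"
    "f \<in> matroid.closure P A" "f \<in> matroid.closure P B"
    "\<And>Y. Y \<in> indeps L \<Longrightarrow> card Y \<le> Suc (rank L (A \<inter> B)) \<Longrightarrow> insert f Y \<in> indeps P"
proof -
  have sub: "A \<subseteq> E" "B \<subseteq> E" "A \<inter> B \<subseteq> E" using A B by (auto simp: flat_def)
  have "\<not> modular_pair L A B" using defect by (simp add: modular_pair_def)
  then have "\<not> cl (\<pi> ` A) \<inter> cl (\<pi> ` B) \<subseteq> cl (\<pi> ` (A \<inter> B))"
    using modular_pair_L[OF sub(1,2)] by auto
  then obtain e where e: "e \<in> cl (\<pi> ` A)" "e \<in> cl (\<pi> ` B)" "e \<notin> cl (\<pi> ` (A \<inter> B))"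
    by blast
  have eV: "e \<in> V" by (rule subsetD[OF cl_subset[OF image_subset_V[OF sub(1)]] e(1)])
  define \<rho> where "\<rho> = \<pi>(f := e)"
  have \<rho>: "\<rho> f = e" "\<rho> ` S = \<pi> ` S" if "S \<subseteq> E" for S
    using f that by (auto simp: \<rho>_def)
  interpret F: linear_family cl V \<rho> "insert f E"
    by unfold_locales (use finite_E in_V eV in \<open>auto simp: \<rho>_def\<close>)
  have ind: "I \<in> indeps F.L \<longleftrightarrow> I \<in> indeps L" if I: "I \<subseteq> E" for I
  proof -
    have "\<rho> x = \<pi> x" "\<rho> ` (I - {x}) = \<pi> ` (I - {x})" if "x \<in> I" for x
      using f I that by (auto simp: \<rho>_def)
    then show ?thesis using I unfolding F.indeps_L_iff indeps_L_iff by auto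
  qed
  have clE: "x \<in> F.L.closure S \<longleftrightarrow> x \<in> L.closure S" if "S \<subseteq> E" "x \<in> E" for S x
  proof -
    have "\<rho> x = \<pi> x" using f that by (auto simp: \<rho>_def)
    moreover have "F.L.closure S = {x \<in> insert f E. \<rho> x \<in> cl (\<rho> ` S)}"
      using that by (intro F.closure_L) auto
    ultimately show ?thesis using that \<rho>(2)[of S] closure_L[of S] by simp
  qed
  have clf: "f \<in> F.L.closure S \<longleftrightarrow> e \<in> cl (\<pi> ` S)" if "S \<subseteq> E" for S
  proof -
    have "F.L.closure S = {x \<in> insert f E. \<rho> x \<in> cl (\<rho> ` S)}"
      using that by (intro F.closure_L) auto
    then show ?thesis using \<rho>[OF that] by simp
  qed
  let ?X = "A \<inter> B"
  define P where "P = principal_extension F.L f (insert f ?X)"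
  have mP: "matroid P" unfolding P_def by (rule F.L.matroid_principal_extension) simp
  interpret P: matroid P by (rule mP)
  have gP: "ground P = insert f E" by (simp add: P_def principal_extension_def)
  have indP: "I \<in> indeps P \<longleftrightarrow> I \<in> indeps L" if I: "I \<subseteq> E" for I
  proof -
    have "I - {f} = I" "f \<notin> I" using I f by auto
    then show ?thesis using ind[OF I] by (simp add: P_def principal_extension_def)
  qed
  have insP: "insert f I \<in> indeps P \<longleftrightarrow> I \<in> indeps L \<and> \<not> insert f ?X \<subseteq> F.L.closure I" if I: "I \<subseteq> E" for I
  proof -
    have "insert f I - {f} = I" using I f by auto
    then show ?thesis using ind[OF I] by (simp add: P_def principal_extension_def)
  qed
  have restr: "restriction P E = L"
    using indP indeps_L_iff gP by (auto simp: restriction_def linear_matroid_def)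
  have "f \<in> P.closure S" if S: "S \<subseteq> E" "f \<in> F.L.closure S" "?X \<subseteq> S" for S
  proof -
    obtain I where I: "I \<in> indeps F.L" "I \<subseteq> S" "card I = rank F.L S" by (rule F.L.obtain_basis)
    have IE: "I \<subseteq> E" "f \<notin> I" using I S f by auto
    have "F.L.closure I = F.L.closure S" using F.L.closure_basis[OF I] S by auto
    moreover have "S \<subseteq> F.L.closure S" using S by (intro F.L.subset_closure) auto
    ultimately have "insert f ?X \<subseteq> F.L.closure I" using S by blast
    then have "insert f I \<notin> indeps P" using insP[OF IE(1)] by simp
    moreover have "I \<in> indeps P" using indP[OF IE(1)] ind[OF IE(1)] I by simp
    ultimately have "f \<in> P.closure I" using P.indep_insert_iff[of I f] IE gP by blast
    then show ?thesis using P.closure_mono[OF I(2)] by blast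
  qed
  then have fAB: "f \<in> P.closure A" "f \<in> P.closure B" using clf e sub by auto
  \<comment> \<open>A violating \<open>Y\<close> spans \<open>?X\<close> and the old position of
    \<open>f\<close>. Having no more elements than a basis of that flat, it lies inside it, hence in
    both flats \<open>A\<close> and \<open>B\<close>. But then \<open>e\<close> would lie in the
    closure of \<open>A \<inter> B\<close>.\<close>
  have small: "insert f Y \<in> indeps P" if Y: "Y \<in> indeps L" "card Y \<le> Suc (rank L ?X)" for Y
  proof (rule ccontr)
    assume neg: "insert f Y \<notin> indeps P"
    have YE: "Y \<subseteq> E" using Y by (simp add: indeps_L_iff)
    then have fX: "insert f ?X \<subseteq> F.L.closure Y" using insP neg Y by blast
    obtain I where I: "I \<in> indeps L" "I \<subseteq> ?X" "card I = rank L ?X" by (rule L.obtain_basis)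
    have IE: "I \<subseteq> E" using I sub by blast
    have "cl (\<pi> ` I) \<subseteq> cl (\<pi> ` ?X)" by (rule cl_image_mono[OF I(2) sub(3)])
    then have "f \<notin> F.L.closure I" using clf[OF IE] e by blast
    then have fI: "insert f I \<in> indeps F.L"
      using F.L.indep_insert_iff[of I f] ind[OF IE] I IE f by auto
    have "card Y \<le> card (insert f I)" 
    proof -
      have "f \<notin> I" using IE f by blast
      then show ?thesis using Y I(3) L.indep_finite[OF I(1)] by simp
    qed
    then have "F.L.closure Y \<subseteq> F.L.closure (insert f I)"
      using F.L.subset_closure_of_max[OF fI, of Y] ind[OF YE] Y fX I by blast
    then have Ysub: "Y \<subseteq> F.L.closure (insert f I)" using F.L.subset_closure[of Y] YE by auto
    have "Y \<subseteq> S" if S: "flat L S" "?X \<subseteq> S" "e \<in> cl (\<pi> ` S)" for S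
    proof -
      have SE: "S \<subseteq> E" using S by (auto simp: flat_def)
      have "insert f I \<subseteq> F.L.closure S"
      proof -
        have "S \<subseteq> F.L.closure S" using SE by (intro F.L.subset_closure) auto
        then show ?thesis using clf[OF SE] S I by blast
      qed
      then have "F.L.closure (insert f I) \<subseteq> F.L.closure S"
        using F.L.closure_subset_closure[of S "insert f I"] SE by auto
      then have "Y \<subseteq> L.closure S" using Ysub clE[OF SE] YE by blast
      then show ?thesis using S by (simp add: L.flat_iff)
    qed
    from this[OF A Int_lower1 e(1)] this[OF B Int_lower2 e(2)] have "Y \<subseteq> ?X" by simp
    then have "F.L.closure Y \<subseteq> F.L.closure ?X" by (rule F.L.closure_mono)
    then have "f \<in> F.L.closure ?X" using fX by auto
    then show False using clf[OF sub(3)] e by simp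
  qed
  show ?thesis by (rule that[OF mP gP restr fAB small])
qed

section \<open>Realizations as linear matroids\<close>

interpretation scale_fun: vector_space scale_fun
  by (rule vector_space_scale_fun)

lemma linear_closure_span: "linear_closure (module.span scale_fun) UNIV"
proof
  fix S T :: "('a \<Rightarrow> 'b::field) set" and u v w
  show "S \<subseteq> scale_fun.span S" by (rule scale_fun.span_superset)
  show "scale_fun.span S \<subseteq> scale_fun.span T" if "S \<subseteq> T" using that by (rule scale_fun.span_mono)
  show "scale_fun.span T \<subseteq> scale_fun.span S" if "T \<subseteq> scale_fun.span S"
    using that by (simp add: scale_fun.span_minimal)
  show "v \<in> scale_fun.span (insert w S)" if "w \<in> scale_fun.span (insert v S)" "w \<notin> scale_fun.span S"
    using that by (rule scale_fun.in_span_insert)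
  show "v - w \<in> scale_fun.span S" if "v \<in> scale_fun.span S" "w \<in> scale_fun.span S"
    using that by (rule scale_fun.span_diff)
  show "\<exists>v\<in>scale_fun.span S. \<exists>w\<in>scale_fun.span T. u = v + w" if "u \<in> scale_fun.span (S \<union> T)"
    using that by (auto simp: scale_fun.span_Un)
qed auto

text \<open>This matches the realization to the independent sets of \<open>linear_matroid\<close>: a
  repeated vector lies in the span of its other copy, so the condition on families includes
  injectivity.\<close>

lemma indep_family_iff:
  "inj_on \<phi> X \<and> \<not> scale_fun.dependent (\<phi> ` X) \<longleftrightarrow> (\<forall>x\<in>X. \<phi> x \<notin> scale_fun.span (\<phi> ` (X - {x})))"
proof (intro iffI conjI ballI)
  fix x assume "inj_on \<phi> X \<and> \<not> scale_fun.dependent (\<phi> ` X)" "x \<in> X"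
  moreover from this have "\<phi> ` X - {\<phi> x} = \<phi> ` (X - {x})" by (auto simp: inj_on_def)
  ultimately show "\<phi> x \<notin> scale_fun.span (\<phi> ` (X - {x}))" by (auto simp: scale_fun.dependent_def)
next
  assume *: "\<forall>x\<in>X. \<phi> x \<notin> scale_fun.span (\<phi> ` (X - {x}))"
  show inj: "inj_on \<phi> X"
  proof (rule inj_onI, rule ccontr)
    fix x y assume xy: "x \<in> X" "y \<in> X" "\<phi> x = \<phi> y" "x \<noteq> y"
    then have "\<phi> x \<in> \<phi> ` (X - {x})" by auto
    then have "\<phi> x \<in> scale_fun.span (\<phi> ` (X - {x}))" by (rule scale_fun.span_base)
    then show False using bspec[OF * xy(1)] by simp
  qed
  have "\<phi> ` X - {\<phi> x} = \<phi> ` (X - {x})" if "x \<in> X" for x using inj that by (auto simp: inj_on_def)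
  then show "\<not> scale_fun.dependent (\<phi> ` X)" using * by (auto simp: scale_fun.dependent_def)
qed

lemma realizable_sticky_modular:
  fixes M :: "'a::infinite set_system"
  assumes M: "matroid M" and real: "realizable_over TYPE('k::field) M" and sticky: "sticky M"
  shows "modular M"
proof (rule ccontr)
  assume nmod: "\<not> modular M"
  interpret matroid M by fact
  obtain n and \<phi> :: "'a \<Rightarrow> nat \<Rightarrow> 'k" where "(\<forall>x\<in>ground M. \<forall>i\<ge>n. \<phi> x i = 0) \<and>
      (\<forall>X\<subseteq>ground M. X \<in> indeps M \<longleftrightarrow> inj_on \<phi> X \<and> \<not> scale_fun.dependent (\<phi> ` X))"
    using real unfolding realizable_over_def by (elim exE)
  then have \<phi>: "X \<in> indeps M \<longleftrightarrow> (\<forall>x\<in>X. \<phi> x \<notin> scale_fun.span (\<phi> ` (X - {x})))"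
    if "X \<subseteq> ground M" for X
    using that by (simp add: indep_family_iff)
  interpret S: linear_closure "module.span scale_fun :: (nat \<Rightarrow> 'k) set \<Rightarrow> _" UNIV
    by (rule linear_closure_span)
  interpret F: linear_family "module.span scale_fun" UNIV \<phi> "ground M"
    by unfold_locales (use finite_ground in auto)
  have "indeps F.L = indeps M"
  proof (rule set_eqI)
    fix X
    show "X \<in> indeps F.L \<longleftrightarrow> X \<in> indeps M"
      using \<phi>[of X] indeps_subset_ground[of X] F.indeps_L_iff[of X] by (cases "X \<subseteq> ground M") auto
  qed
  then have L: "F.L = M" by (simp add: S.linear_matroid_def)
  obtain A B where AB: "flat M A" "flat M B"
    "rank M A + rank M B = rank M (A \<union> B) + Suc (rank M (A \<inter> B))"
    using obtain_defect_one[OF nmod] .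
  obtain f where f: "f \<notin> ground M" using ex_new_if_finite[OF infinite_UNIV finite_ground] by auto
  show False
  proof (rule F.extension_of_defect_one[OF f, unfolded L, OF AB])
    fix P
    assume P: "matroid P" "ground P = insert f (ground M)" "restriction P (ground M) = M"
      "f \<in> matroid.closure P A" "f \<in> matroid.closure P B"
      "\<And>Y. Y \<in> indeps M \<Longrightarrow> card Y \<le> Suc (rank M (A \<inter> B)) \<Longrightarrow> insert f Y \<in> indeps P"
    have "\<not> sticky M"
      by (rule not_sticky_of_extension[OF M P(1) f P(2,3,6) _ _ AB(3) P(4,5)])
        (use AB in \<open>auto simp: flat_def\<close>)
    then show False using sticky by simp
  qed
qed

section \<open>Residue fields of finitely generated rings\<close>

locale subring_of =
  fixes R :: "'k::field set"
  assumes one_in: "1 \<in> R"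
    and diff_in: "a \<in> R \<Longrightarrow> b \<in> R \<Longrightarrow> a - b \<in> R"
    and mult_in: "a \<in> R \<Longrightarrow> b \<in> R \<Longrightarrow> a * b \<in> R"
begin

lemma zero_in: "0 \<in> R"
  using diff_in[OF one_in one_in] by simp

lemma uminus_in: "a \<in> R \<Longrightarrow> - a \<in> R"
  using diff_in[OF zero_in, of a] by simp

lemma add_in: "a \<in> R \<Longrightarrow> b \<in> R \<Longrightarrow> a + b \<in> R"
  using diff_in[OF _ uminus_in, of a b] by simp

lemma power_in: "a \<in> R \<Longrightarrow> a ^ n \<in> R"
  by (induction n) (auto intro: one_in mult_in)

end

locale ideal_of = subring_of +
  fixes J :: "'k::field set"
  assumes sub: "a \<in> J \<Longrightarrow> a \<in> R"
    and zero_mem: "0 \<in> J"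
    and diff_mem: "a \<in> J \<Longrightarrow> b \<in> J \<Longrightarrow> a - b \<in> J"
    and mult_mem: "r \<in> R \<Longrightarrow> a \<in> J \<Longrightarrow> r * a \<in> J"
begin

lemma uminus_mem: "a \<in> J \<Longrightarrow> - a \<in> J"
  using diff_mem[OF zero_mem, of a] by simp

lemma add_mem: "a \<in> J \<Longrightarrow> b \<in> J \<Longrightarrow> a + b \<in> J"
  using diff_mem[OF _ uminus_mem, of a b] by simp

lemma mult_mem': "r \<in> R \<Longrightarrow> a \<in> J \<Longrightarrow> a * r \<in> J"
  using mult_mem[of r a] by (simp add: mult.commute)

lemma sum_mem: "(\<And>i. i \<in> I \<Longrightarrow> g i \<in> J) \<Longrightarrow> sum g I \<in> J"
  by (induction I rule: infinite_finite_induct) (auto intro: zero_mem add_mem)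

end

text \<open>The quotient of \<open>R\<close> by \<open>J\<close> is a finite field, expressed
  without forming it: congruence modulo \<open>J\<close> stands for equality, and \<open>F\<close>
  need not contain unique representatives.\<close>

locale finite_residue_field = ideal_of +
  assumes one_notin: "1 \<notin> J"
    and inverse_mod: "r \<in> R \<Longrightarrow> r \<notin> J \<Longrightarrow> \<exists>s\<in>R. r * s - 1 \<in> J"
    and finite_residues: "\<exists>F. finite F \<and> F \<subseteq> R \<and> (\<forall>r\<in>R. \<exists>s\<in>F. r - s \<in> J)"
begin

lemma prime_mem:
  assumes "a \<in> R" "b \<in> R" "a * b \<in> J" "a \<notin> J"
  shows "b \<in> J"
proof -
  obtain s where s: "s \<in> R" "a * s - 1 \<in> J" using inverse_mod assms by blast
  have "s * (a * b) - b * (a * s - 1) \<in> J"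
    by (rule diff_mem[OF mult_mem[OF s(1) assms(3)] mult_mem[OF assms(2) s(2)]])
  then show ?thesis by (simp add: algebra_simps)
qed

lemma power_notin: "a \<in> R \<Longrightarrow> a \<notin> J \<Longrightarrow> a ^ n \<notin> J"
  by (induction n) (use one_notin prime_mem power_in in auto)

end

text \<open>Finiteness replaces Zorn's lemma: a proper ideal above \<open>J\<close> with the most
  representatives from \<open>F\<close> is maximal. A larger proper ideal would gain no
  representative, yet every element of \<open>R\<close> differs from a representative by an element
  of \<open>J\<close>.\<close>

lemma (in ideal_of) finite_residue_field_above:
  assumes one: "1 \<notin> J" and F: "finite F" "F \<subseteq> R" "\<forall>r\<in>R. \<exists>s\<in>F. r - s \<in> J"
  obtains m where "J \<subseteq> m" "finite_residue_field R m"
proof -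
  define ok where "ok m \<longleftrightarrow> J \<subseteq> m \<and> ideal_of R m \<and> 1 \<notin> m" for m
  have "\<exists>m. ok m \<and> (\<forall>m'. ok m' \<longrightarrow> card (m' \<inter> F) \<le> card (m \<inter> F))"
  proof (rule ex_has_greatest_nat)
    show "ok J" using one by (simp add: ok_def ideal_of_axioms)
    show "\<forall>m. ok m \<longrightarrow> card (m \<inter> F) < Suc (card F)"
      using F by (auto intro: card_mono simp: less_Suc_eq_le)
  qed
  then obtain m where m: "ok m" "\<And>m'. ok m' \<Longrightarrow> card (m' \<inter> F) \<le> card (m \<inter> F)" by blast
  interpret m: ideal_of R m using m by (simp add: ok_def)
  have Jm: "J \<subseteq> m" using m by (simp add: ok_def)
  have inv: "\<exists>s\<in>R. r * s - 1 \<in> m" if r: "r \<in> R" "r \<notin> m" for r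
  proof (rule ccontr)
    assume neg: "\<not> ?thesis"
    \<comment> \<open>The ideal generated by \<open>m\<close> and \<open>r\<close>; it is proper
      because \<open>r\<close> has no inverse modulo \<open>m\<close>.\<close>
    define m' where "m' = {a + r * s |a s. a \<in> m \<and> s \<in> R}"
    have "ideal_of R m'"
    proof (unfold_locales, goal_cases)
      case (1 a)
      then show ?case using r by (auto simp: m'_def intro: add_in mult_in m.sub)
    next
      case 2
      then show ?case unfolding m'_def
        by (rule CollectI, rule exI[of _ 0], rule exI[of _ 0]) (simp add: m.zero_mem zero_in)
    next
      case (3 a b)
      then obtain a' s b' t where "a = a' + r * s" "b = b' + r * t" "a' \<in> m" "b' \<in> m" "s \<in> R" "t \<in> R"
        by (auto simp: m'_def)
      then have "a - b = (a' - b') + r * (s - t)" "a' - b' \<in> m" "s - t \<in> R"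
        by (auto simp: algebra_simps intro: m.diff_mem diff_in)
      then show ?case unfolding m'_def by blast
    next
      case (4 q a)
      then obtain a' s where "a = a' + r * s" "a' \<in> m" "s \<in> R" by (auto simp: m'_def)
      then have "q * a = q * a' + r * (q * s)" "q * a' \<in> m" "q * s \<in> R"
        using 4 m.mult_mem[of q a'] mult_in[of q s] by (simp_all add: algebra_simps)
      then show ?case unfolding m'_def by blast
    qed
    then interpret m': ideal_of R m' .
    have mm': "m \<subseteq> m'"
    proof
      fix a assume "a \<in> m"
      then have "a = a + r * 0 \<and> a \<in> m \<and> 0 \<in> R" using zero_in by simp
      then show "a \<in> m'" unfolding m'_def by (intro CollectI exI)
    qed
    have "r = 0 + r * 1 \<and> 0 \<in> m \<and> 1 \<in> R" using one_in m.zero_mem by simp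
    then have rm': "r \<in> m'" unfolding m'_def by (intro CollectI exI)
    have "1 \<notin> m'"
    proof
      assume "1 \<in> m'"
      then obtain a s where as: "1 = a + r * s" "a \<in> m" "s \<in> R" by (auto simp: m'_def)
      then have "r * s - 1 = - a" by (simp add: algebra_simps)
      then show False using neg as m.uminus_mem by auto
    qed
    then have "ok m'" using Jm mm' m'.ideal_of_axioms by (auto simp: ok_def)
    then have "m \<inter> F = m' \<inter> F"
      using m(2) mm' F by (intro card_seteq) auto
    moreover obtain s where s: "s \<in> F" "r - s \<in> J" using F r by blast
    moreover have "s \<in> m'" using m'.diff_mem[OF rm', of "r - s"] s Jm mm' by auto
    ultimately have "s \<in> m" by blast
    then have "r - s + s \<in> m" using s Jm by (intro m.add_mem) auto
    then show False using r by simp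
  qed
  have "finite_residue_field R m"
  proof
    show "1 \<notin> m" using m(1) by (simp add: ok_def)
    have "\<forall>r\<in>R. \<exists>s\<in>F. r - s \<in> m" using F(3) Jm by blast
    then show "\<exists>F. finite F \<and> F \<subseteq> R \<and> (\<forall>r\<in>R. \<exists>s\<in>F. r - s \<in> m)" using F by blast
  qed (rule inv)
  then show ?thesis using that Jm by blast
qed

section \<open>Polynomials over a subring and the adjunction of one element\<close>

definition polys_over :: "'k::field set \<Rightarrow> 'k poly set" where
  "polys_over R = {p. \<forall>i. coeff p i \<in> R}"

definition adjoin :: "'k::field set \<Rightarrow> 'k \<Rightarrow> 'k set" where
  "adjoin R t = (\<lambda>p. poly p t) ` polys_over R"

context subring_of
begin

lemma sum_in: "(\<And>i. i \<in> I \<Longrightarrow> g i \<in> R) \<Longrightarrow> sum g I \<in> R"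
  by (induction I rule: infinite_finite_induct) (auto intro: zero_in add_in)

lemma polys_diff: "p \<in> polys_over R \<Longrightarrow> q \<in> polys_over R \<Longrightarrow> p - q \<in> polys_over R"
  by (auto simp: polys_over_def intro: diff_in)

lemma polys_add: "p \<in> polys_over R \<Longrightarrow> q \<in> polys_over R \<Longrightarrow> p + q \<in> polys_over R"
  by (auto simp: polys_over_def intro: add_in)

lemma polys_mult: "p \<in> polys_over R \<Longrightarrow> q \<in> polys_over R \<Longrightarrow> p * q \<in> polys_over R"
  by (auto simp: polys_over_def coeff_mult intro!: sum_in mult_in)

lemma polys_smult: "c \<in> R \<Longrightarrow> q \<in> polys_over R \<Longrightarrow> smult c q \<in> polys_over R"
  by (auto simp: polys_over_def intro: mult_in)

lemma polys_pCons: "c \<in> R \<Longrightarrow> q \<in> polys_over R \<Longrightarrow> pCons c q \<in> polys_over R"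
  by (auto simp: polys_over_def coeff_pCons split: nat.splits)

lemma polys_0: "0 \<in> polys_over R"
  by (simp add: polys_over_def zero_in)

lemma polys_monom: "c \<in> R \<Longrightarrow> monom c n \<in> polys_over R"
  by (auto simp: polys_over_def zero_in)

lemma polys_1: "1 \<in> polys_over R"
  using polys_pCons[OF one_in polys_0] by (simp add: one_pCons)

lemma subring_of_adjoin: "subring_of (adjoin R t)"
proof
  show "1 \<in> adjoin R t" unfolding adjoin_def using polys_1 by (intro image_eqI[of _ _ 1]) auto
  fix a b assume "a \<in> adjoin R t" "b \<in> adjoin R t"
  then obtain p q where pq: "a = poly p t" "b = poly q t" "p \<in> polys_over R" "q \<in> polys_over R"
    by (auto simp: adjoin_def)
  then show "a - b \<in> adjoin R t" "a * b \<in> adjoin R t"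
    unfolding adjoin_def using polys_diff[of p q] polys_mult[of p q]
    by (auto intro: image_eqI[of _ _ "p - q"] image_eqI[of _ _ "p * q"])
qed

lemma subset_adjoin: "R \<subseteq> adjoin R t"
proof
  fix a assume "a \<in> R"
  then have "[:a:] \<in> polys_over R" using polys_pCons polys_0 by blast
  then show "a \<in> adjoin R t" unfolding adjoin_def by (intro image_eqI[of _ _ "[:a:]"]) auto
qed

lemma mem_adjoin: "t \<in> adjoin R t"
proof -
  have "[:0, 1:] \<in> polys_over R" using polys_pCons polys_0 zero_in one_in by blast
  then show ?thesis unfolding adjoin_def by (intro image_eqI[of _ _ "[:0, 1:]"]) auto
qed

text \<open>Division with remainder would need the inverse of the leading coefficient of
  \<open>g\<close>; instead, each cancellation of a top term multiplies by that coefficient.\<close>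

lemma pseudo_division:
  assumes g: "g \<in> polys_over R" "g \<noteq> 0" and w: "w \<in> polys_over R"
  shows "\<exists>n q r. q \<in> polys_over R \<and> r \<in> polys_over R \<and> smult (lead_coeff g ^ n) w = g * q + r \<and>
           (r = 0 \<or> degree r < degree g)"
  using w
proof (induction "degree w" arbitrary: w rule: less_induct)
  case less
  let ?c = "lead_coeff g"
  have c: "?c \<in> R" using g by (simp add: polys_over_def)
  show ?case
  proof (cases "w = 0 \<or> degree w < degree g")
    case True
    then show ?thesis using less.prems polys_0
      by (intro exI[of _ 0] exI[of _ 0] exI[of _ w]) auto
  next
    case False
    define u where "u = monom (lead_coeff w) (degree w - degree g)"
    define w' where "w' = smult ?c w - g * u"
    have u: "u \<in> polys_over R" using less.prems by (auto simp: u_def polys_over_def intro: polys_monom zero_in)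
    have w': "w' \<in> polys_over R" unfolding w'_def using u g less.prems c
      by (intro polys_diff polys_smult polys_mult)
    have degu: "degree (g * u) = degree w" using g False
      by (subst degree_mult_eq) (auto simp: u_def degree_monom_eq)
    have "degree w' \<le> degree w" unfolding w'_def using degu degree_smult_le
      by (intro degree_diff_le) auto
    moreover have "coeff w' (degree w) = 0"
    proof -
      have "coeff (g * u) (degree w) = lead_coeff (g * u)" using degu by simp
      also have "\<dots> = ?c * lead_coeff w" using False by (simp add: lead_coeff_mult u_def degree_monom_eq)
      finally show ?thesis by (simp add: w'_def)
    qed
    ultimately have dw': "w' = 0 \<or> degree w' < degree w"
      by (metis leading_coeff_0_iff le_neq_implies_less)
    have "\<exists>n q r. q \<in> polys_over R \<and> r \<in> polys_over R \<and> smult (?c ^ n) w' = g * q + r \<and>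
           (r = 0 \<or> degree r < degree g)"
    proof (cases "w' = 0")
      case True
      then show ?thesis using polys_0 by (intro exI[of _ 0] exI[of _ 0] exI[of _ 0]) auto
    next
      case False
      then show ?thesis using less.hyps[of w'] dw' w' by blast
    qed
    then obtain n q r where qr: "q \<in> polys_over R" "r \<in> polys_over R"
      "smult (?c ^ n) w' = g * q + r" "r = 0 \<or> degree r < degree g" by blast
    have "smult (?c ^ Suc n) w = smult (?c ^ n) w' + smult (?c ^ n) (g * u)"
      by (simp add: w'_def smult_diff_right mult.commute)
    also have "\<dots> = g * (q + smult (?c ^ n) u) + r" by (simp add: qr algebra_simps)
    finally have "smult (?c ^ Suc n) w = g * (q + smult (?c ^ n) u) + r" .
    moreover have "q + smult (?c ^ n) u \<in> polys_over R"
      using qr u c power_in by (intro polys_add polys_smult) auto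
    ultimately show ?thesis using qr by blast
  qed
qed

end

text \<open>Modulo \<open>J\<close> this is a degree argument over a field: a product with
  \<open>G\<close>, which keeps its positive degree, is constant only if \<open>Q\<close> vanishes.
  The coefficients of \<open>Q\<close> enter \<open>J\<close> from the top down, read off from
  \<open>G * Q\<close> at the positive index \<open>degree G + j\<close>.\<close>

lemma (in finite_residue_field) coeff_0_mem_of_mult:
  assumes G: "G \<in> polys_over R" "lead_coeff G \<notin> J" "degree G > 0" and Q: "Q \<in> polys_over R"
    and pos: "\<And>i. i > 0 \<Longrightarrow> coeff (G * Q) i \<in> J"
  shows "coeff (G * Q) 0 \<in> J"
proof -
  have GR: "coeff G i \<in> R" and QR: "coeff Q i \<in> R" for i using G Q by (auto simp: polys_over_def)
  have "coeff Q j \<in> J" for j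
  proof (induction "degree Q - j" arbitrary: j rule: less_induct)
    case less
    have higher: "coeff Q i \<in> J" if "i > j" for i
    proof (cases "i > degree Q")
      case True
      then show ?thesis by (simp add: coeff_eq_0 zero_mem)
    next
      case False
      then show ?thesis using less.hyps[of i] that by auto
    qed
    let ?d = "degree G"
    have "coeff (G * Q) (?d + j) = (\<Sum>i\<le>?d + j. coeff G i * coeff Q (?d + j - i))"
      by (rule coeff_mult)
    also have "\<dots> = coeff G ?d * coeff Q j + (\<Sum>i\<in>{..?d + j} - {?d}. coeff G i * coeff Q (?d + j - i))"
      by (subst sum.remove[of _ ?d]) auto
    finally have eq: "coeff G ?d * coeff Q j =
        coeff (G * Q) (?d + j) - (\<Sum>i\<in>{..?d + j} - {?d}. coeff G i * coeff Q (?d + j - i))"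
      by simp
    have "coeff G i * coeff Q (?d + j - i) \<in> J" if "i \<noteq> ?d" for i
    proof (cases "i < ?d")
      case True
      then show ?thesis using higher GR by (intro mult_mem) auto
    next
      case False
      then show ?thesis using that by (simp add: coeff_eq_0 zero_mem)
    qed
    then have "coeff G ?d * coeff Q j \<in> J"
      unfolding eq using pos G by (intro diff_mem sum_mem) auto
    then show ?case using prime_mem GR QR G by blast
  qed
  then show ?thesis using GR by (simp add: coeff_mult mult_mem)
qed

text \<open>Equivalently, the maximal ideals of \<open>R\<close> with finite residue field have
  intersection zero.\<close>

definition has_finite_residue_fields :: "'k::field set \<Rightarrow> bool" where
  "has_finite_residue_fields R \<longleftrightarrow> subring_of R \<and>
     (\<forall>f\<in>R - {0}. \<exists>m. finite_residue_field R m \<and> f \<notin> m)"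

text \<open>The residue fields are prime fields. In characteristic zero, a prime larger than
  \<open>\<bar>z\<bar>\<close> does not divide \<open>z\<close>; in positive characteristic,
  \<open>p\<close> has to be the characteristic and \<open>m\<close> is the zero ideal.\<close>

lemma has_finite_residue_fields_Ints: "has_finite_residue_fields (range of_int :: 'k::field set)"
  unfolding has_finite_residue_fields_def
proof (intro conjI ballI)
  let ?Z = "range of_int :: 'k set"
  interpret Z: subring_of ?Z
  proof
    show "1 \<in> ?Z" by (metis of_int_1 rangeI)
    show "a - b \<in> ?Z" "a * b \<in> ?Z" if "a \<in> ?Z" "b \<in> ?Z" for a b
      using that by (auto simp flip: of_int_diff of_int_mult)
  qed
  show "subring_of ?Z" ..
  fix f assume "f \<in> ?Z - {0}"
  then obtain z where z: "f = of_int z" "of_int z \<noteq> (0::'k)" by auto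
  obtain p :: nat where p: "prime p" "CHAR('k) = 0 \<or> CHAR('k) = p" "\<not> int p dvd z"
  proof (cases "CHAR('k) = 0")
    case True
    then have "z \<noteq> 0" using z by auto
    obtain p where p: "prime p" "p > nat \<bar>z\<bar>" using bigger_prime by blast
    have "\<not> int p dvd z"
      using p zdvd_imp_le[of "int p" "\<bar>z\<bar>"] \<open>z \<noteq> 0\<close> by auto
    then show ?thesis using that p True by blast
  next
    case False
    then have "prime CHAR('k)" using prime_CHAR_semidom by blast
    moreover have "\<not> int CHAR('k) dvd z" using z of_int_eq_0_iff_char_dvd by blast
    ultimately show ?thesis using that by blast
  qed
  define m where "m = (\<lambda>y. of_int (int p * y) :: 'k) ` UNIV"
  have mem: "of_int a \<in> m \<longleftrightarrow> int p dvd a" for a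
  proof
    assume "of_int a \<in> m"
    then obtain y where "of_int a = (of_int (int p * y) :: 'k)" by (auto simp: m_def)
    then have "of_int (a - int p * y) = (0 :: 'k)" by simp
    then have "int CHAR('k) dvd a - int p * y" using of_int_eq_0_iff_char_dvd by blast
    then have "int p dvd a - int p * y" using p(2) by auto
    then show "int p dvd a" by (metis dvd_add_right_iff dvd_triv_left diff_add_cancel add.commute)
  next
    assume "int p dvd a"
    then obtain y where "a = int p * y" by (rule dvdE)
    then show "of_int a \<in> m" unfolding m_def by blast
  qed
  have pp: "prime (int p)" using p by simp
  have "finite_residue_field ?Z m"
  proof (unfold_locales, goal_cases)
    case (1 a)
    then show ?case by (auto simp: m_def simp del: of_int_mult)
  next
    case 2
    show ?case using mem[of 0] by simp
  next
    case (3 a b)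
    then obtain x y where "a = of_int (int p * x)" "b = of_int (int p * y)" by (auto simp: m_def)
    then have "a - b = of_int (int p * (x - y))" by (simp add: algebra_simps)
    then show ?case by (simp only: mem) simp
  next
    case (4 r a)
    then obtain x y where "a = of_int (int p * x)" "r = of_int y" by (auto simp: m_def)
    then have "r * a = of_int (int p * (y * x))" by (simp add: algebra_simps)
    then show ?case by (simp only: mem) simp
  next
    case 5
    show ?case using mem[of 1] pp not_prime_unit by auto
  next
    case (6 r)
    then obtain x where x: "r = of_int x" "\<not> int p dvd x" using mem by auto
    then have "coprime x (int p)" using prime_imp_coprime[OF pp] by (simp add: coprime_commute)
    then obtain u v where uv: "x * u + int p * v = 1" by (metis bezout_int coprime_imp_gcd_eq_1 mult.commute)
    then have "x * u - 1 = int p * (- v)" by (simp add: algebra_simps)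
    then have "of_int (x * u - 1) \<in> m" unfolding mem by simp
    then show ?case using x by (intro bexI[of _ "of_int u"]) auto
  next
    case 7
    have "\<exists>s\<in>of_int ` {0..<int p}. of_int x - s \<in> m" for x
    proof (intro bexI[of _ "of_int (x mod int p)"])
      have "of_int (x - x mod int p) \<in> m" unfolding mem by (rule dvd_minus_mod)
      then show "of_int x - of_int (x mod int p) \<in> m" by simp
      show "of_int (x mod int p) \<in> of_int ` {0..<int p}"
        using prime_gt_0_nat[OF p(1)] by (intro imageI) auto
    qed
    then show ?case by (intro exI[of _ "of_int ` {0..<int p}"]) auto
  qed
  moreover have "f \<notin> m" using z mem p by simp
  ultimately show "\<exists>m. finite_residue_field ?Z m \<and> f \<notin> m" by blast
qed

text \<open>If \<open>t\<close> is transcendental over \<open>R\<close> and \<open>f = p(t)\<close>, then \<open>G = X p + 1\<close> works; otherwise \<open>G\<close> has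
  minimal degree with \<open>G(t) = 0\<close>. For an ideal \<open>m\<close> of \<open>R\<close> avoiding \<open>b\<close> and the leading coefficient of
  \<open>G\<close>, the last clause makes the ideal generated by \<open>m\<close> and \<open>G(t)\<close> proper.\<close>

lemma (in subring_of) adjoin_modulus:
  assumes f: "f \<in> adjoin R t" "f \<noteq> 0"
  obtains G b h s where "G \<in> polys_over R" "degree G > 0" "b \<in> R" "b \<noteq> 0"
    "h \<in> adjoin R t" "s \<in> polys_over R" "b = f * h + poly s t * poly G t"
    "\<And>w s. w \<in> polys_over R \<Longrightarrow> s \<in> polys_over R \<Longrightarrow> poly w t = poly s t * poly G t \<Longrightarrow>
       \<exists>n. \<exists>Q\<in>polys_over R. smult (lead_coeff G ^ n) w = G * Q"
proof -
  obtain p where p: "p \<in> polys_over R" "f = poly p t" using f by (auto simp: adjoin_def)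
  show ?thesis
  proof (cases "\<exists>g\<in>polys_over R. g \<noteq> 0 \<and> poly g t = 0")
    case False
    let ?G = "pCons 1 p"
    have G: "?G \<in> polys_over R" "degree ?G > 0" using p f polys_pCons one_in by auto
    have t: "- t \<in> adjoin R t"
    proof -
      interpret A: subring_of "adjoin R t" by (rule subring_of_adjoin)
      show ?thesis using A.uminus_in mem_adjoin by blast
    qed
    \<comment> \<open>Modulo the value \<open>1 + t * f\<close> of \<open>?G\<close> at
      \<open>t\<close>, the element \<open>f\<close> has the inverse \<open>- t\<close>.\<close>
    have eq: "1 = f * (- t) + poly 1 t * poly ?G t" using p by (simp add: algebra_simps)
    have "\<exists>n. \<exists>Q\<in>polys_over R. smult (lead_coeff ?G ^ n) w = ?G * Q"
      if w: "w \<in> polys_over R" "s \<in> polys_over R" "poly w t = poly s t * poly ?G t" for w s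
    proof -
      have "w - s * ?G \<in> polys_over R" using w G by (intro polys_diff polys_mult)
      moreover have "poly (w - s * ?G) t = 0" using w by (simp only: poly_diff poly_mult diff_self)
      ultimately have "w - s * ?G = 0" using False by blast
      then have "smult (lead_coeff ?G ^ 0) w = ?G * s" by (simp add: mult.commute)
      then show ?thesis using w by blast
    qed
    then show ?thesis by (rule that[OF G one_in one_neq_zero t polys_1 eq])
  next
    case True
    then obtain g where g: "g \<in> polys_over R" "g \<noteq> 0" "poly g t = 0"
      and min: "\<And>q. q \<in> polys_over R \<Longrightarrow> q \<noteq> 0 \<Longrightarrow> poly q t = 0 \<Longrightarrow> degree g \<le> degree q"
      using exists_least_iff[of "\<lambda>n. \<exists>q\<in>polys_over R. q \<noteq> 0 \<and> poly q t = 0 \<and> degree q = n"]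
      by (metis not_less)
    have dg: "degree g > 0"
    proof (rule ccontr)
      assume "\<not> degree g > 0"
      then obtain a where "g = [:a:]" using degree_eq_zeroE by blast
      then show False using g by simp
    qed
    interpret A: subring_of "adjoin R t" by (rule subring_of_adjoin)
    have inA: "poly q t \<in> adjoin R t" if "q \<in> polys_over R" for q using that by (auto simp: adjoin_def)
    \<comment> \<open>These polynomials have a nonzero multiple of \<open>f\<close> as their value
      at \<open>t\<close>. One of least degree turns out to be constant, and that constant is
      \<open>b\<close>.\<close>
    define mult where "mult w \<longleftrightarrow> w \<in> polys_over R \<and> poly w t \<noteq> 0 \<and> (\<exists>h\<in>adjoin R t. poly w t = f * h)" for w
    have "mult p" using p f A.one_in by (auto simp: mult_def)
    then obtain w where w: "mult w" and wmin: "\<And>v. mult v \<Longrightarrow> degree w \<le> degree v"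
      using exists_least_iff[of "\<lambda>n. \<exists>v. mult v \<and> degree v = n"] by (metis not_less)
    have w0: "w \<noteq> 0" "w \<in> polys_over R" "poly w t \<noteq> 0" using w by (auto simp: mult_def)
    obtain h where h: "h \<in> adjoin R t" "poly w t = f * h" using w by (auto simp: mult_def)
    have lead0: "lead_coeff q ^ n \<noteq> 0" if "q \<noteq> 0" for q :: "'k poly" and n using that by simp
    have leadR: "lead_coeff q ^ n \<in> R" if "q \<in> polys_over R" for q n
      using that by (intro power_in) (simp add: polys_over_def)
    have wg: "degree w < degree g"
    proof -
      obtain n q r where qr: "q \<in> polys_over R" "r \<in> polys_over R"
        "smult (lead_coeff g ^ n) w = g * q + r" "r = 0 \<or> degree r < degree g"
        using pseudo_division[OF g(1,2) w0(2)] by blast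
      have "poly r t = lead_coeff g ^ n * poly w t"
        using arg_cong[OF qr(3), of "\<lambda>p. poly p t"] g by simp
      then have "poly r t = f * (lead_coeff g ^ n * h)" "poly r t \<noteq> 0"
        using h w0 lead0[OF g(2)] by auto
      moreover have "lead_coeff g ^ n * h \<in> adjoin R t"
        using leadR[OF g(1)] subset_adjoin h by (intro A.mult_in) auto
      ultimately have "mult r" using qr by (auto simp: mult_def)
      moreover have "r \<noteq> 0" using \<open>poly r t \<noteq> 0\<close> by auto
      ultimately show ?thesis using wmin[of r] qr(4) by simp
    qed
    \<comment> \<open>Minimality of \<open>g\<close> acts as irreducibility. Pseudo-division of
      \<open>g\<close> by a nonconstant \<open>w\<close> leaves a multiple of \<open>f\<close> of
      smaller degree, which vanishes at \<open>t\<close> by minimality of \<open>w\<close> and is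
      zero by minimality of \<open>g\<close>. The quotient \<open>q\<close> would then have the root
      \<open>t\<close> and smaller degree than \<open>g\<close>.\<close>
    have "degree w = 0"
    proof (rule ccontr)
      assume dw: "degree w \<noteq> 0"
      obtain n q r where qr: "q \<in> polys_over R" "r \<in> polys_over R"
        "smult (lead_coeff w ^ n) g = w * q + r" "r = 0 \<or> degree r < degree w"
        using pseudo_division[OF w0(2,1) g(1)] by blast
      have rt: "poly r t = - (poly w t * poly q t)"
        using arg_cong[OF qr(3), of "\<lambda>p. poly p t"] g by (simp add: eq_neg_iff_add_eq_0 add.commute)
      then have "poly r t = f * (- (h * poly q t))" using h by simp
      moreover have "- (h * poly q t) \<in> adjoin R t" using h inA qr by (intro A.uminus_in A.mult_in)
      ultimately have ex: "\<exists>h\<in>adjoin R t. poly r t = f * h" by blast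
      have "poly r t = 0"
      proof (rule ccontr)
        assume nz: "poly r t \<noteq> 0"
        then have "mult r" using ex qr(2) by (simp add: mult_def)
        moreover have "r \<noteq> 0" using nz by auto
        ultimately show False using wmin[of r] qr(4) by simp
      qed
      then have "r = 0" using min[of r] qr wg by fastforce
      have qt: "poly q t = 0" using rt \<open>poly r t = 0\<close> w0 by simp
      have "smult (lead_coeff w ^ n) g = w * q" using qr \<open>r = 0\<close> by simp
      moreover from this have "q \<noteq> 0" using g lead0[OF w0(1), of n] by auto
      ultimately have "degree g = degree w + degree q"
        using w0 lead0[OF w0(1), of n] degree_smult_eq[of "lead_coeff w ^ n" g] degree_mult_eq[of w q] by simp
      then show False using min[of q] qr \<open>q \<noteq> 0\<close> qt dw by simp
    qed
    then obtain b where b: "w = [:b:]" using degree_eq_zeroE by blast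
    have b': "b \<in> R" "b \<noteq> 0" "b = f * h + poly 0 t * poly g t"
      using w0 b h by (auto simp: polys_over_def coeff_pCons split: nat.splits)
    have "\<exists>n. \<exists>Q\<in>polys_over R. smult (lead_coeff g ^ n) v = g * Q"
      if v: "v \<in> polys_over R" "s \<in> polys_over R" "poly v t = poly s t * poly g t" for v s
    proof -
      obtain n q r where qr: "q \<in> polys_over R" "r \<in> polys_over R"
        "smult (lead_coeff g ^ n) v = g * q + r" "r = 0 \<or> degree r < degree g"
        using pseudo_division[OF g(1,2) v(1)] by blast
      have "poly r t = 0" using arg_cong[OF qr(3), of "\<lambda>p. poly p t"] g v by simp
      then have "r = 0" using min[of r] qr by fastforce
      then show ?thesis using qr by auto
    qed
    then show ?thesis by (rule that[OF g(1) dg b'(1,2) h(1) polys_0 b'(3)])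
  qed
qed

text \<open>The leading coefficient of \<open>G\<close> is inverted only modulo \<open>m\<close>;
  the error this leaves in the top coefficient lies in \<open>m\<close> and is collected in
  \<open>M\<close>.\<close>

lemma (in subring_of) reduce_degree:
  assumes m: "finite_residue_field R m"
    and G: "G \<in> polys_over R" "lead_coeff G \<notin> m" "degree G > 0" and p: "p \<in> polys_over R"
  shows "\<exists>r s M. r \<in> polys_over R \<and> s \<in> polys_over R \<and> M \<in> polys_over m \<and>
           degree r < degree G \<and> p = r + M + s * G"
  using p
proof (induction "degree p" arbitrary: p rule: less_induct)
  case less
  interpret m: finite_residue_field R m by (rule m)
  have M0: "0 \<in> polys_over m" by (simp add: polys_over_def m.zero_mem)
  show ?case
  proof (cases "degree p < degree G")
    case True
    then show ?thesis using less.prems polys_0 M0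
      by (intro exI[of _ p] exI[of _ 0]) auto
  next
    case False
    let ?n = "degree p" and ?b = "lead_coeff p" and ?c = "lead_coeff G"
    have bc: "?b \<in> R" "?c \<in> R" using less.prems G by (auto simp: polys_over_def)
    obtain c' where c': "c' \<in> R" "?c * c' - 1 \<in> m" using m.inverse_mod[OF bc(2) G(2)] by blast
    define u where "u = monom (?b * c') (?n - degree G)"
    define a where "a = - (?b * (?c * c' - 1))"
    define p' where "p' = p - u * G - monom a ?n"
    have a: "a \<in> m" unfolding a_def by (intro m.uminus_mem m.mult_mem bc c')
    have u: "u \<in> polys_over R" unfolding u_def by (intro polys_monom mult_in bc c')
    have p': "p' \<in> polys_over R"
      unfolding p'_def using u G less.prems a m.sub by (intro polys_diff polys_mult polys_monom)
    have du: "degree (u * G) \<le> ?n"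
      using degree_mult_le[of u G] degree_monom_le[of "?b * c'" "?n - degree G"] False
      by (simp add: u_def)
    have cu: "coeff (u * G) ?n = ?b * c' * ?c"
      using coeff_mult_degree_sum[of "monom 1 (?n - degree G)" G] False
      by (simp add: u_def coeff_monom_mult)
    have "degree p' \<le> ?n"
      unfolding p'_def using du degree_monom_le by (intro degree_diff_le) auto
    moreover have "coeff p' ?n = 0"
      using cu by (simp add: p'_def a_def algebra_simps)
    moreover have "?n > 0" using G False by simp
    ultimately have "degree p' < ?n"
      by (metis degree_0 leading_coeff_0_iff le_neq_implies_less)
    then obtain r s M where rsM: "r \<in> polys_over R" "s \<in> polys_over R" "M \<in> polys_over m"
      "degree r < degree G" "p' = r + M + s * G" using less.hyps[of p'] p' by blast
    have "p = r + (M + monom a ?n) + (s + u) * G"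
      using rsM(5) by (simp add: p'_def algebra_simps)
    moreover have "M + monom a ?n \<in> polys_over m"
      using rsM(3) a by (auto simp: polys_over_def intro: m.add_mem m.zero_mem)
    moreover have "s + u \<in> polys_over R" using rsM u by (intro polys_add)
    ultimately show ?thesis using rsM by blast
  qed
qed

text \<open>An ideal \<open>m\<close> of \<open>R\<close> avoiding the leading coefficient of
  \<open>G\<close> and \<open>b\<close> generates, together with the value of \<open>G\<close> at
  \<open>t\<close>, an ideal \<open>J\<close> of the larger ring. Reduction of degrees makes its
  residues finite in number. A proper ideal above \<open>J\<close> cannot contain \<open>f\<close>:
  modulo \<open>J\<close>, the element \<open>b\<close> is a multiple of \<open>f\<close>, and it is
  invertible already modulo \<open>m\<close>.\<close>

lemma has_finite_residue_fields_adjoin: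
  assumes R: "has_finite_residue_fields R"
  shows "has_finite_residue_fields (adjoin R t)"
  unfolding has_finite_residue_fields_def
proof (intro conjI ballI)
  interpret subring_of R using R by (simp add: has_finite_residue_fields_def)
  show "subring_of (adjoin R t)" by (rule subring_of_adjoin)
  interpret A: subring_of "adjoin R t" by (rule subring_of_adjoin)
  have inA: "poly q t \<in> adjoin R t" if "q \<in> polys_over R" for q using that by (auto simp: adjoin_def)
  fix f assume "f \<in> adjoin R t - {0}"
  then have f: "f \<in> adjoin R t" "f \<noteq> 0" by auto
  show "\<exists>n. finite_residue_field (adjoin R t) n \<and> f \<notin> n"
  proof (rule adjoin_modulus[OF f])
    fix G b h s
    assume G: "G \<in> polys_over R" "degree G > 0" and b: "b \<in> R" "b \<noteq> 0"
      and h: "h \<in> adjoin R t" "s \<in> polys_over R" "b = f * h + poly s t * poly G t"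
      and mult: "\<And>w s. w \<in> polys_over R \<Longrightarrow> s \<in> polys_over R \<Longrightarrow> poly w t = poly s t * poly G t \<Longrightarrow>
       \<exists>n. \<exists>Q\<in>polys_over R. smult (lead_coeff G ^ n) w = G * Q"
    let ?c = "lead_coeff G"
    have c: "?c \<in> R" "?c \<noteq> 0" using G by (auto simp: polys_over_def)
    then have "?c * b \<in> R - {0}" using b mult_in by simp
    then obtain m where m: "finite_residue_field R m" "?c * b \<notin> m"
      using R unfolding has_finite_residue_fields_def by meson
    interpret m: finite_residue_field R m by (rule m)
    have cm: "?c \<notin> m" and bm: "b \<notin> m" using m(2) m.mult_mem m.mult_mem' b c by blast+
    have mR: "polys_over m \<subseteq> polys_over R" using m.sub by (auto simp: polys_over_def)
    have mdiff: "p - q \<in> polys_over m" if "p \<in> polys_over m" "q \<in> polys_over m" for p q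
      using that by (auto simp: polys_over_def intro: m.diff_mem)
    have mmult: "p * q \<in> polys_over m" if "p \<in> polys_over R" "q \<in> polys_over m" for p q
      using that by (auto simp: polys_over_def coeff_mult intro!: m.sum_mem m.mult_mem)
    have m0: "0 \<in> polys_over m" by (simp add: polys_over_def m.zero_mem)
    define J where "J = {poly (M + s * G) t |M s. M \<in> polys_over m \<and> s \<in> polys_over R}"
    have JI: "poly (M + s * G) t \<in> J" if "M \<in> polys_over m" "s \<in> polys_over R" for M s
      using that by (auto simp: J_def)
    interpret J: ideal_of "adjoin R t" J
    proof (unfold_locales, goal_cases)
      case (1 a)
      then obtain M s where Ms: "a = poly (M + s * G) t" "M \<in> polys_over m" "s \<in> polys_over R"
        by (auto simp: J_def)
      have "M + s * G \<in> polys_over R" using Ms G mR by (intro polys_add polys_mult) auto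
      then show ?case unfolding Ms(1) by (rule inA)
    next
      case 2
      show ?case using JI[OF m0 polys_0] by simp
    next
      case (3 a b)
      then obtain M s M' s' where Ms: "a = poly (M + s * G) t" "M \<in> polys_over m" "s \<in> polys_over R"
        "b = poly (M' + s' * G) t" "M' \<in> polys_over m" "s' \<in> polys_over R"
        by (auto simp: J_def)
      have "a - b = poly ((M - M') + (s - s') * G) t" by (simp add: Ms algebra_simps)
      then show ?case using JI mdiff polys_diff Ms by metis
    next
      case (4 r a)
      then obtain M s q where Ms: "a = poly (M + s * G) t" "M \<in> polys_over m" "s \<in> polys_over R"
        "r = poly q t" "q \<in> polys_over R"
        by (auto simp: J_def adjoin_def)
      have "r * a = poly (q * M + (q * s) * G) t" by (simp add: Ms algebra_simps)
      then show ?case using JI mmult polys_mult Ms by metis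
    qed
    have constJ: "a \<in> J" if "a \<in> m" for a
    proof -
      have "[:a:] \<in> polys_over m" using that m.zero_mem by (simp add: polys_over_def coeff_pCons split: nat.split)
      then show ?thesis using JI[OF _ polys_0, of "[:a:]"] by simp
    qed
    have "1 \<notin> J"
    proof
      assume "1 \<in> J"
      then obtain M s where Ms: "1 = poly (M + s * G) t" "M \<in> polys_over m" "s \<in> polys_over R"
        by (auto simp: J_def)
      have "1 - M \<in> polys_over R" using Ms mR polys_1 by (intro polys_diff) auto
      moreover have "poly (1 - M) t = poly s t * poly G t" using Ms(1) by (simp add: algebra_simps)
      ultimately obtain n Q where Q: "Q \<in> polys_over R" "smult (?c ^ n) (1 - M) = G * Q"
        using mult Ms(3) by blast
      have Mm: "coeff M i \<in> m" for i using Ms by (simp add: polys_over_def)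
      have cn: "?c ^ n \<in> R" by (rule power_in[OF c(1)])
      \<comment> \<open>The product is \<open>?c ^ n\<close> times \<open>1 - M\<close>, hence
        constant modulo \<open>m\<close>. Being a multiple of \<open>G\<close>, it must vanish
        modulo \<open>m\<close>, which would put \<open>?c ^ n\<close> into
        \<open>m\<close>.\<close>
      have "coeff (G * Q) i \<in> m" if "i > 0" for i
      proof -
        have "coeff (G * Q) i = - (?c ^ n * coeff M i)"
          using that by (simp flip: Q(2) add: one_pCons coeff_pCons split: nat.split)
        then show ?thesis using m.uminus_mem m.mult_mem[OF cn Mm] by simp
      qed
      then have "coeff (G * Q) 0 \<in> m" by (rule m.coeff_0_mem_of_mult[OF G(1) cm G(2) Q(1)])
      moreover have "coeff (G * Q) 0 = ?c ^ n - ?c ^ n * coeff M 0"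
        by (simp flip: Q(2) add: algebra_simps)
      ultimately have "?c ^ n - ?c ^ n * coeff M 0 + ?c ^ n * coeff M 0 \<in> m"
        using m.add_mem m.mult_mem[OF cn Mm] by metis
      then show False using m.power_notin[OF c(1) cm] by simp
    qed
    obtain F where F: "finite F" "F \<subseteq> R" "\<forall>r\<in>R. \<exists>s\<in>F. r - s \<in> m" using m.finite_residues by blast
    \<comment> \<open>Every residue modulo \<open>J\<close> is represented by a polynomial of degree
      below \<open>degree G\<close>, and its coefficients may be replaced by representatives from
      \<open>F\<close>.\<close>
    define F' where "F' = (\<lambda>xs. poly (Poly xs) t) ` {xs. set xs \<subseteq> F \<and> length xs = degree G}"
    have "finite F'" unfolding F'_def using F by (intro finite_imageI finite_lists_length_eq)
    moreover have "F' \<subseteq> adjoin R t"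
    proof
      fix a assume "a \<in> F'"
      then obtain xs where xs: "a = poly (Poly xs) t" "set xs \<subseteq> F" by (auto simp: F'_def)
      have "Poly xs \<in> polys_over R"
        using xs(2) F(2) zero_in by (auto simp: polys_over_def nth_default_def dest!: nth_mem)
      then show "a \<in> adjoin R t" using inA xs by simp
    qed
    moreover have "\<forall>r\<in>adjoin R t. \<exists>s\<in>F'. r - s \<in> J"
    proof
      fix a assume "a \<in> adjoin R t"
      then obtain p where p: "a = poly p t" "p \<in> polys_over R" by (auto simp: adjoin_def)
      obtain r s M where rsM: "r \<in> polys_over R" "s \<in> polys_over R" "M \<in> polys_over m"
        "degree r < degree G" "p = r + M + s * G"
        using reduce_degree[OF m(1) G(1) cm G(2) p(2)] by blast
      have "\<forall>i. \<exists>s. s \<in> F \<and> coeff r i - s \<in> m" using F(3) rsM(1) by (auto simp: polys_over_def)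
      then obtain g where g: "\<And>i. g i \<in> F" "\<And>i. coeff r i - g i \<in> m" by metis
      define xs where "xs = map g [0..<degree G]"
      have "coeff (r - Poly xs) i \<in> m" for i
        using g rsM(4) m.zero_mem by (auto simp: xs_def nth_default_def coeff_eq_0)
      then have "M + (r - Poly xs) \<in> polys_over m"
        using rsM(3) m.add_mem by (simp add: polys_over_def)
      then have "poly (M + (r - Poly xs) + s * G) t \<in> J" by (rule JI[OF _ rsM(2)])
      moreover have "poly (M + (r - Poly xs) + s * G) t = a - poly (Poly xs) t"
        by (simp add: p rsM(5))
      ultimately have "a - poly (Poly xs) t \<in> J" by (simp only:)
      moreover have "poly (Poly xs) t \<in> F'"
        unfolding F'_def by (intro imageI) (use g in \<open>auto simp: xs_def\<close>)
      ultimately show "\<exists>s\<in>F'. a - s \<in> J" by (rule bexI)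
    qed
    ultimately obtain n where n: "J \<subseteq> n" "finite_residue_field (adjoin R t) n"
      using J.finite_residue_field_above[OF \<open>1 \<notin> J\<close>] by metis
    interpret n: finite_residue_field "adjoin R t" n by (rule n)
    have "f \<notin> n"
    proof
      assume "f \<in> n"
      then have "f * h \<in> n" by (rule n.mult_mem'[OF h(1)])
      moreover have "poly s t * poly G t \<in> n" using JI[OF m0 h(2)] n(1) by auto
      ultimately have "b \<in> n" using n.add_mem h(3) by simp
      obtain b' where b': "b' \<in> R" "b * b' - 1 \<in> m" using m.inverse_mod[OF b(1) bm] by blast
      have "b * b' \<in> n" using n.mult_mem'[OF _ \<open>b \<in> n\<close>] b'(1) subset_adjoin by auto
      moreover have "b * b' - 1 \<in> n" using constJ[OF b'(2)] n(1) by auto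
      ultimately have "b * b' - (b * b' - 1) \<in> n" by (rule n.diff_mem)
      then show False using n.one_notin by simp
    qed
    then show "\<exists>n. finite_residue_field (adjoin R t) n \<and> f \<notin> n" using n by blast
  qed
qed

text \<open>The elements of \<open>T\<close> are adjoined one at a time to the image of the
  integers; at the end the element to be avoided is \<open>1\<close>.\<close>

lemma finite_subset_finite_residue_field:
  fixes T :: "'k::field set"
  assumes "finite T"
  obtains R m where "T \<subseteq> R" "finite_residue_field R m"
proof -
  have "\<exists>R. T \<subseteq> R \<and> has_finite_residue_fields R"
    using assms
  proof (induction T)
    case empty
    then show ?case using has_finite_residue_fields_Ints by blast
  next
    case (insert t T)
    then obtain R where R: "T \<subseteq> R" "has_finite_residue_fields R" by blast
    interpret subring_of R using R by (simp add: has_finite_residue_fields_def)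
    have "insert t T \<subseteq> adjoin R t" using R subset_adjoin mem_adjoin by auto
    then show ?case using has_finite_residue_fields_adjoin[OF R(2)] by blast
  qed
  then obtain R where R: "T \<subseteq> R" "has_finite_residue_fields R" by blast
  interpret subring_of R using R by (simp add: has_finite_residue_fields_def)
  have "1 \<in> R - {0}" using one_in by simp
  then obtain m where "finite_residue_field R m"
    using R unfolding has_finite_residue_fields_def by meson
  then show ?thesis using that R by blast
qed

section \<open>Embedding into a finite projective geometry\<close>

text \<open>Subspaces of \<open>(R/m)\<^sup>n\<close> are represented by their preimages in \<open>R\<^sup>n\<close>, which avoids a type for the
  residue field.\<close>

inductive_set residue_span :: "'k::field set \<Rightarrow> 'k set \<Rightarrow> nat \<Rightarrow> (nat \<Rightarrow> 'k) set \<Rightarrow> (nat \<Rightarrow> 'k) set"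
  for R m n S where
  base: "v \<in> S \<Longrightarrow> v \<in> residue_span R m n S"
| small: "(\<And>i. v i \<in> m) \<Longrightarrow> (\<And>i. i \<ge> n \<Longrightarrow> v i = 0) \<Longrightarrow> v \<in> residue_span R m n S"
| diff: "v \<in> residue_span R m n S \<Longrightarrow> w \<in> residue_span R m n S \<Longrightarrow> v - w \<in> residue_span R m n S"
| scale: "r \<in> R \<Longrightarrow> v \<in> residue_span R m n S \<Longrightarrow> scale_fun r v \<in> residue_span R m n S"

definition vectors_over :: "'k::field set \<Rightarrow> nat \<Rightarrow> (nat \<Rightarrow> 'k) set" where
  "vectors_over R n = {v. (\<forall>i. v i \<in> R) \<and> (\<forall>i\<ge>n. v i = 0)}"

section \<open>Linear algebra modulo an ideal\<close>

context finite_residue_field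
begin

abbreviation "rspan n \<equiv> residue_span R J n"

lemma rspan_zero: "0 \<in> rspan n S"
  by (rule residue_span.small) (auto simp: zero_mem)

lemma rspan_least: "T \<subseteq> rspan n S \<Longrightarrow> v \<in> rspan n T \<Longrightarrow> v \<in> rspan n S"
  by (rotate_tac 1, induction v rule: residue_span.induct) (auto intro: residue_span.intros)

lemma rspan_insert:
  assumes "w \<in> rspan n (insert v S)"
  shows "\<exists>r\<in>R. w - scale_fun r v \<in> rspan n S"
  using assms
proof (induction w rule: residue_span.induct)
  case (base w)
  show ?case
  proof (cases "w = v")
    case True
    then have "w - scale_fun 1 v = 0" by (simp add: scale_fun_def fun_eq_iff)
    then have "w - scale_fun 1 v \<in> rspan n S" using rspan_zero by simp
    then show ?thesis using one_in by blast
  next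
    case False
    then show ?thesis using base zero_in by (intro bexI[of _ 0]) (auto intro: residue_span.base)
  qed
next
  case (small w)
  then show ?case using zero_in by (intro bexI[of _ 0]) (auto intro: residue_span.small)
next
  case (diff w1 w2)
  then obtain r1 r2 where r: "r1 \<in> R" "w1 - scale_fun r1 v \<in> rspan n S"
    "r2 \<in> R" "w2 - scale_fun r2 v \<in> rspan n S" by blast
  have "w1 - w2 - scale_fun (r1 - r2) v = (w1 - scale_fun r1 v) - (w2 - scale_fun r2 v)"
    by (simp add: scale_fun.scale_left_diff_distrib)
  then show ?case using r by (metis residue_span.diff diff_in)
next
  case (scale c w)
  then obtain r where r: "r \<in> R" "w - scale_fun r v \<in> rspan n S" by blast
  have "scale_fun c w - scale_fun (c * r) v = scale_fun c (w - scale_fun r v)"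
    by (simp add: scale_fun.scale_right_diff_distrib)
  then show ?case using r scale(1) by (metis residue_span.scale mult_in)
qed

lemma rspan_add: "v \<in> rspan n S \<Longrightarrow> w \<in> rspan n S \<Longrightarrow> v + w \<in> rspan n S"
  using residue_span.diff[OF _ residue_span.diff[OF rspan_zero]] by fastforce

lemma rspan_sum: "(\<And>i. i \<in> I \<Longrightarrow> g i \<in> rspan n S) \<Longrightarrow> sum g I \<in> rspan n S"
  by (induction I rule: infinite_finite_induct) (auto intro: rspan_zero rspan_add)

text \<open>Exchange is where the residue field matters. If \<open>w\<close> is congruent to
  \<open>r v\<close> modulo the span of \<open>S\<close> and lies outside it, then \<open>r\<close>
  is not in \<open>J\<close>. With an inverse \<open>r'\<close> modulo \<open>J\<close>, the vector
  \<open>v\<close> is \<open>r' (r v)\<close> minus \<open>(r r' - 1) v\<close>, and the latter has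
  all coordinates in \<open>J\<close>.\<close>

lemma linear_closure_rspan: "linear_closure (rspan n) (vectors_over R n)"
proof
  fix S T u v w
  show "S \<subseteq> rspan n S" by (auto intro: residue_span.base)
  show "rspan n T \<subseteq> rspan n S" if "T \<subseteq> rspan n S" using rspan_least[OF that] by blast
  show "rspan n S \<subseteq> rspan n T" if "S \<subseteq> T"
    using rspan_least[of S n T] that by (auto intro: residue_span.base)
  show "v - w \<in> rspan n S" if "v \<in> rspan n S" "w \<in> rspan n S"
    using that by (rule residue_span.diff)
  show "rspan n S \<subseteq> vectors_over R n" if S: "S \<subseteq> vectors_over R n"
  proof
    fix v assume "v \<in> rspan n S"
    then show "v \<in> vectors_over R n"
    proof (induction v rule: residue_span.induct)
      case (base v)
      then show ?case using S by blast
    qed (auto simp: vectors_over_def scale_fun_def sub intro: diff_in mult_in)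
  qed
  show "v \<in> rspan n (insert w S)"
    if v: "v \<in> vectors_over R n" and w: "w \<in> rspan n (insert v S)" "w \<notin> rspan n S"
  proof -
    obtain r where r: "r \<in> R" "w - scale_fun r v \<in> rspan n S" using rspan_insert[OF w(1)] by blast
    have "r \<notin> J"
    proof
      assume "r \<in> J"
      then have "scale_fun r v \<in> rspan n S"
        using v by (intro residue_span.small) (auto simp: vectors_over_def scale_fun_def intro: mult_mem')
      then have "w - scale_fun r v + scale_fun r v \<in> rspan n S" by (rule rspan_add[OF r(2)])
      then show False using w by simp
    qed
    then obtain r' where r': "r' \<in> R" "r * r' - 1 \<in> J" using inverse_mod r(1) by blast
    have "rspan n S \<subseteq> rspan n (insert w S)"
      using rspan_least[of S n "insert w S"] by (auto intro: residue_span.base)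
    then have "w - scale_fun r v \<in> rspan n (insert w S)" using r(2) by (rule subsetD)
    moreover have "w \<in> rspan n (insert w S)" by (rule residue_span.base) simp
    ultimately have "w - (w - scale_fun r v) \<in> rspan n (insert w S)"
      by (rule residue_span.diff[rotated])
    then have "scale_fun r' (scale_fun r v) \<in> rspan n (insert w S)"
      by (intro residue_span.scale[OF r'(1)]) simp
    moreover have "scale_fun (r * r' - 1) v \<in> rspan n (insert w S)"
      using v r' by (intro residue_span.small) (auto simp: vectors_over_def scale_fun_def intro: mult_mem')
    ultimately have "scale_fun r' (scale_fun r v) - scale_fun (r * r' - 1) v \<in> rspan n (insert w S)"
      by (rule residue_span.diff)
    moreover have "scale_fun r' (scale_fun r v) - scale_fun (r * r' - 1) v = v"
      by (simp add: scale_fun_def fun_eq_iff algebra_simps)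
    ultimately show ?thesis by simp
  qed
  show "\<exists>v\<in>rspan n S. \<exists>w\<in>rspan n T. u = v + w" if "u \<in> rspan n (S \<union> T)"
    using that
  proof (induction u rule: residue_span.induct)
    case (base v)
    then show ?case
    proof
      assume "v \<in> S"
      then show ?thesis using rspan_zero by (intro bexI[of _ v] bexI[of _ 0]) (auto intro: residue_span.base)
    next
      assume "v \<in> T"
      then show ?thesis using rspan_zero by (intro bexI[of _ 0] bexI[of _ v]) (auto intro: residue_span.base)
    qed
  next
    case (small v)
    then have "v \<in> rspan n S" by (rule residue_span.small)
    then show ?case using rspan_zero by (intro bexI[of _ v] bexI[of _ 0]) auto
  next
    case (diff u1 u2)
    then obtain v1 w1 v2 w2 where "v1 \<in> rspan n S" "w1 \<in> rspan n T" "u1 = v1 + w1"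
      "v2 \<in> rspan n S" "w2 \<in> rspan n T" "u2 = v2 + w2" by blast
    then show ?case by (intro bexI[of _ "v1 - v2"] bexI[of _ "w1 - w2"]) (auto intro: residue_span.diff)
  next
    case (scale r u)
    then obtain v w where "v \<in> rspan n S" "w \<in> rspan n T" "u = v + w" by blast
    then show ?case using scale(1)
      by (intro bexI[of _ "scale_fun r v"] bexI[of _ "scale_fun r w"])
        (auto intro: residue_span.scale simp: scale_fun.scale_right_distrib)
  qed
qed

text \<open>This certifies that a vector stays outside a span after reduction: a functional over
  \<open>R\<close> that vanishes on \<open>S\<close> and is \<open>1\<close> at the vector separates
  them modulo \<open>J\<close> as well.\<close>

lemma rspan_functional:
  assumes "\<And>i. i < n \<Longrightarrow> \<psi> i \<in> R" and "\<And>v. v \<in> S \<Longrightarrow> (\<Sum>i<n. \<psi> i * v i) \<in> J"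
    and "v \<in> rspan n S"
  shows "(\<Sum>i<n. \<psi> i * v i) \<in> J"
  using assms(3)
proof (induction v rule: residue_span.induct)
  case (base v)
  then show ?case by (rule assms(2))
next
  case (small v)
  then show ?case using assms(1) by (auto intro!: sum_mem mult_mem)
next
  case (diff v w)
  have "(\<Sum>i<n. \<psi> i * (v - w) i) = (\<Sum>i<n. \<psi> i * v i) - (\<Sum>i<n. \<psi> i * w i)"
    by (simp add: algebra_simps sum_subtractf)
  then show ?case using diff by (simp add: diff_mem)
next
  case (scale r v)
  have "(\<Sum>i<n. \<psi> i * scale_fun r v i) = r * (\<Sum>i<n. \<psi> i * v i)"
    by (simp add: scale_fun_def sum_distrib_left mult.left_commute)
  then show ?case using scale by (simp add: mult_mem)
qed

lemma finite_vector_residues: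
  obtains F where "finite F" "F \<subseteq> vectors_over R n"
    "\<forall>v\<in>vectors_over R n. \<exists>w\<in>F. v - w \<in> rspan n {}"
proof -
  obtain F where F: "finite F" "F \<subseteq> R" "\<forall>r\<in>R. \<exists>s\<in>F. r - s \<in> J" using finite_residues by blast
  define G where "G = (\<lambda>xs i. if i < n then xs ! i else 0) ` {xs. set xs \<subseteq> F \<and> length xs = n}"
  have "finite G" unfolding G_def using F by (intro finite_imageI finite_lists_length_eq)
  moreover have "G \<subseteq> vectors_over R n"
  proof
    fix v assume "v \<in> G"
    then obtain xs where xs: "v = (\<lambda>i. if i < n then xs ! i else 0)" "set xs \<subseteq> F" "length xs = n"
      by (auto simp: G_def)
    have "xs ! i \<in> R" if "i < n" for i using nth_mem[of i xs] xs F(2) that by blast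
    then show "v \<in> vectors_over R n" using xs(1) zero_in by (simp add: vectors_over_def)
  qed
  moreover have "\<exists>w\<in>G. v - w \<in> rspan n {}" if v: "v \<in> vectors_over R n" for v
  proof -
    have "\<forall>i. \<exists>s. s \<in> F \<and> v i - s \<in> J" using v F(3) by (auto simp: vectors_over_def)
    then obtain g where g: "\<And>i. g i \<in> F" "\<And>i. v i - g i \<in> J" by metis
    define w where "w = (\<lambda>i. if i < n then map g [0..<n] ! i else 0)"
    have "w \<in> G" unfolding G_def w_def by (rule imageI) (use g in auto)
    moreover have "v - w \<in> rspan n {}"
      using v g zero_mem by (intro residue_span.small) (auto simp: w_def vectors_over_def)
    ultimately show ?thesis by blast
  qed
  ultimately show ?thesis using that by blast
qed

end

section \<open>Witnesses for span membership that survive reduction\<close>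

lemma sum_apply: "sum g A x = (\<Sum>a\<in>A. g a x)"
  by (induction A rule: infinite_finite_induct) auto

text \<open>A linear map that is \<open>1\<close> at \<open>v\<close> and \<open>0\<close> on a
  basis of the span of \<open>S\<close> exists by extension. All vectors involved live in the first
  \<open>n\<close> coordinates, so its values at the unit vectors are the coefficients.\<close>

lemma separating_functional:
  fixes v :: "nat \<Rightarrow> 'k::field"
  assumes v: "v \<notin> scale_fun.span S" and vanish: "\<And>u. u \<in> insert v S \<Longrightarrow> \<forall>i\<ge>n. u i = 0"
  shows "\<exists>\<psi> :: nat \<Rightarrow> 'k. (\<forall>u\<in>S. (\<Sum>i<n. \<psi> i * u i) = 0) \<and> (\<Sum>i<n. \<psi> i * v i) = 1"
proof -
  interpret vp: vector_space_pair "scale_fun :: 'k \<Rightarrow> (nat \<Rightarrow> 'k) \<Rightarrow> _" "(*) :: 'k \<Rightarrow> 'k \<Rightarrow> 'k"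
    by unfold_locales (auto simp: algebra_simps)
  obtain B where B: "B \<subseteq> S" "\<not> scale_fun.dependent B" "S \<subseteq> scale_fun.span B"
    using scale_fun.maximal_independent_subset[of S] by metis
  have vB: "v \<notin> scale_fun.span B" using v scale_fun.span_mono[OF B(1)] by blast
  then have "\<not> scale_fun.dependent (insert v B)"
    using B scale_fun.independent_insertI by blast
  then obtain g where g: "Vector_Spaces.linear scale_fun (*) g"
    "\<forall>x\<in>insert v B. g x = (if x = v then 1 else 0)"
    using vp.linear_independent_extend[of "insert v B" "\<lambda>x. if x = v then 1 else 0"] by blast
  interpret g: Vector_Spaces.linear scale_fun "(*)" g by (rule g)
  have "v \<notin> B" using vB scale_fun.span_superset by blast
  then have "g x = 0" if "x \<in> B" for x using g(2) that by auto
  then have gS: "g x = 0" if "x \<in> S" for x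
    using vp.linear_eq_0_on_span[OF g(1), of B x] B(3) that by blast
  define e where "e i = (\<lambda>j. if j = i then 1 else 0 :: 'k)" for i :: nat
  have expand: "(\<Sum>i<n. g (e i) * u i) = g u" if "u \<in> insert v S" for u
  proof -
    have "u = (\<Sum>i<n. scale_fun (u i) (e i))"
    proof
      fix j
      have "(\<Sum>i<n. scale_fun (u i) (e i)) j = (\<Sum>i<n. if i = j then u i else 0)"
        unfolding sum_apply by (rule sum.cong) (auto simp: scale_fun_def e_def)
      then show "u j = (\<Sum>i<n. scale_fun (u i) (e i)) j"
        using vanish[OF that] by simp
    qed
    then have "g u = (\<Sum>i<n. g (scale_fun (u i) (e i)))" by (metis g.sum)
    then show ?thesis by (simp add: g.scale mult.commute)
  qed
  show ?thesis
  proof (intro exI[of _ "\<lambda>i. g (e i)"] conjI ballI)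
    show "(\<Sum>i<n. g (e i) * u i) = 0" if "u \<in> S" for u using expand gS that by simp
    show "(\<Sum>i<n. g (e i) * v i) = 1" using expand g(2) by simp
  qed
qed

text \<open>The set \<open>T\<close> holds the coefficients of a linear combination or of a
  separating functional, whichever exists over the field. It is fixed before \<open>R\<close> and
  \<open>m\<close>, so finitely many certificates can be gathered first and a ring containing them
  chosen afterwards.\<close>

lemma span_certificate:
  fixes v :: "nat \<Rightarrow> 'k::field"
  assumes S: "finite S" and vanish: "\<And>u. u \<in> insert v S \<Longrightarrow> \<forall>i\<ge>n. u i = 0"
  shows "\<exists>T. finite T \<and> (\<forall>R m. finite_residue_field R m \<longrightarrow> T \<subseteq> R \<longrightarrow>
           (v \<in> residue_span R m n S \<longleftrightarrow> v \<in> scale_fun.span S))"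
proof (cases "v \<in> scale_fun.span S")
  case True
  then obtain c where c: "v = (\<Sum>u\<in>S. scale_fun (c u) u)"
    using scale_fun.span_finite[OF S] by auto
  have "v \<in> residue_span R m n S" if R: "finite_residue_field R m" "c ` S \<subseteq> R" for R m
  proof -
    interpret finite_residue_field R m by (rule R)
    show ?thesis unfolding c using R(2)
      by (intro rspan_sum residue_span.scale residue_span.base) auto
  qed
  then show ?thesis using True S by (intro exI[of _ "c ` S"]) auto
next
  case False
  obtain \<psi> where \<psi>: "\<forall>u\<in>S. (\<Sum>i<n. \<psi> i * u i) = 0" "(\<Sum>i<n. \<psi> i * v i) = 1"
    using separating_functional[OF False vanish] by auto
  have "v \<notin> residue_span R m n S" if R: "finite_residue_field R m" "\<psi> ` {..<n} \<subseteq> R" for R m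
  proof
    interpret finite_residue_field R m by (rule R)
    assume "v \<in> residue_span R m n S"
    then have "(\<Sum>i<n. \<psi> i * v i) \<in> m"
      using R(2) \<psi>(1) zero_mem by (intro rspan_functional[of n \<psi> S v]) auto
    then show False using \<psi>(2) one_notin by simp
  qed
  then show ?thesis using False by (intro exI[of _ "\<psi> ` {..<n}"]) auto
qed

text \<open>The idea is Rado's theorem that a realizable matroid is realizable over a finite field: all
  dependences and all separating functionals survive the reduction modulo \<open>m\<close>.\<close>

lemma realizable_embeddable_in_modular:
  fixes M :: "'a set_system"
  assumes M: "matroid M" and real: "realizable_over TYPE('k::field) M"
  shows "embeddable_in_modular M"
proof -
  interpret matroid M by fact
  let ?E = "ground M"
  obtain n and \<phi> :: "'a \<Rightarrow> nat \<Rightarrow> 'k" where *: "(\<forall>x\<in>?E. \<forall>i\<ge>n. \<phi> x i = 0) \<and>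
      (\<forall>X\<subseteq>?E. X \<in> indeps M \<longleftrightarrow> inj_on \<phi> X \<and> \<not> scale_fun.dependent (\<phi> ` X))"
    using real unfolding realizable_over_def by (elim exE)
  then have vanish: "\<phi> x i = 0" if "x \<in> ?E" "i \<ge> n" for x i using that by blast
  have \<phi>: "X \<in> indeps M \<longleftrightarrow> (\<forall>x\<in>X. \<phi> x \<notin> scale_fun.span (\<phi> ` (X - {x})))" if "X \<subseteq> ?E" for X
    using that * by (simp add: indep_family_iff)
  define cert where "cert p T \<longleftrightarrow> finite T \<and> (\<forall>R m. finite_residue_field R m \<longrightarrow> T \<subseteq> R \<longrightarrow>
      (\<phi> (snd p) \<in> residue_span R m n (\<phi> ` fst p) \<longleftrightarrow> \<phi> (snd p) \<in> scale_fun.span (\<phi> ` fst p)))"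
    for p T
  have "\<forall>p\<in>Pow ?E \<times> ?E. \<exists>T. cert p T"
    unfolding cert_def
  proof
    fix p assume p: "p \<in> Pow ?E \<times> ?E"
    then have "fst p \<subseteq> ?E" by auto
    then have "finite (\<phi> ` fst p)" using finite_subset[OF _ finite_ground] by simp
    then show "\<exists>T. finite T \<and> (\<forall>R m. finite_residue_field R m \<longrightarrow> T \<subseteq> R \<longrightarrow>
      (\<phi> (snd p) \<in> residue_span R m n (\<phi> ` fst p) \<longleftrightarrow> \<phi> (snd p) \<in> scale_fun.span (\<phi> ` fst p)))"
      by (rule span_certificate) (use p vanish in auto)
  qed
  then have "\<exists>T. \<forall>p\<in>Pow ?E \<times> ?E. cert p (T p)" by (rule bchoice)
  then obtain T where T: "\<forall>p\<in>Pow ?E \<times> ?E. cert p (T p)" by (elim exE)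
  define coords where "coords = (\<lambda>(x, i). \<phi> x i) ` (?E \<times> {..<n})"
  \<comment> \<open>The coordinates put the vectors into \<open>R\<^sup>n\<close>; the certificates
    make all span relations among them agree before and after reduction.\<close>
  define U where "U = coords \<union> (\<Union>p\<in>Pow ?E \<times> ?E. T p)"
  have "finite U" unfolding U_def coords_def using T finite_ground by (auto simp: cert_def)
  then obtain R m where R: "U \<subseteq> R" "finite_residue_field R m"
    by (rule finite_subset_finite_residue_field)
  interpret R: finite_residue_field R m by (rule R)
  have \<phi>V: "\<phi> x \<in> vectors_over R n" if x: "x \<in> ?E" for x
  proof -
    have "\<phi> x i \<in> R" for i
    proof (cases "i < n")
      case True
      then have "\<phi> x i \<in> coords" using x by (auto simp: coords_def)
      then show ?thesis using R(1) by (auto simp: U_def)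
    next
      case False
      then show ?thesis using vanish x R.zero_in by simp
    qed
    then show ?thesis using vanish x by (simp add: vectors_over_def)
  qed
  have span_iff: "\<phi> x \<in> residue_span R m n (\<phi> ` X) \<longleftrightarrow> \<phi> x \<in> scale_fun.span (\<phi> ` X)"
    if "X \<subseteq> ?E" "x \<in> ?E" for X x
  proof -
    have p: "(X, x) \<in> Pow ?E \<times> ?E" using that by simp
    then have "T (X, x) \<subseteq> U" unfolding U_def by (intro le_supI2 UN_upper)
    then have "T (X, x) \<subseteq> R" using R(1) by (rule order_trans)
    then show ?thesis using bspec[OF T p] R(2) by (simp add: cert_def)
  qed
  obtain F where F: "finite F" "F \<subseteq> vectors_over R n"
    "\<forall>v\<in>vectors_over R n. \<exists>w\<in>F. v - w \<in> residue_span R m n {}"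
    by (rule R.finite_vector_residues[of n])
  define k where "k = card ?E"
  obtain f where f: "bij_betw f ?E {..<k}"
    using ex_bij_betw_finite_nat[OF finite_ground] by (auto simp: k_def atLeast0LessThan)
  obtain g where g: "bij_betw g {..<card F} F"
    using ex_bij_betw_nat_finite[OF F(1)] by (auto simp: atLeast0LessThan)
  \<comment> \<open>Indices below \<open>k\<close> label the elements of \<open>M\<close>, the
    others label representatives of all residue classes of vectors. Keeping the two lists apart
    preserves parallel elements of \<open>M\<close>, which a list of distinct vectors would merge;
    modularity needs only that every class occurs.\<close>
  define \<pi> where "\<pi> j = (if j < k then \<phi> (the_inv_into ?E f j) else g (j - k))" for j
  have \<pi>f: "\<pi> (f x) = \<phi> x" if x: "x \<in> ?E" for x
  proof -
    have "f x < k" using f x by (auto simp: bij_betw_def)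
    then show ?thesis using f x by (simp add: \<pi>_def bij_betw_def the_inv_into_f_f)
  qed
  define E' where "E' = {..<k + card F}"
  have fE: "f ` ?E = {..<k}" using f by (simp add: bij_betw_def)
  have "\<pi> j \<in> vectors_over R n" if j: "j \<in> E'" for j
  proof (cases "j < k")
    case True
    then have "j \<in> f ` ?E" using fE by simp
    then show ?thesis using \<pi>f \<phi>V by auto
  next
    case False
    then have "j - k \<in> {..<card F}" using j by (auto simp: E'_def)
    then have "g (j - k) \<in> F" using g by (auto simp: bij_betw_def)
    then show ?thesis using F(2) False by (auto simp: \<pi>_def)
  qed
  interpret lc: linear_closure "residue_span R m n" "vectors_over R n"
    by (rule R.linear_closure_rspan)
  interpret L: linear_family "residue_span R m n" "vectors_over R n" \<pi> E'
    by unfold_locales (use \<open>\<And>j. j \<in> E' \<Longrightarrow> \<pi> j \<in> vectors_over R n\<close> in \<open>auto simp: E'_def\<close>)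
  have "modular L.L"
  proof (rule L.modular_L)
    fix v assume "v \<in> vectors_over R n"
    then obtain w where w: "w \<in> F" "v - w \<in> residue_span R m n {}" using F(3) by blast
    then obtain j where j: "j < card F" "w = g j" using g by (auto simp: bij_betw_def)
    then have "k + j \<in> E'" "\<pi> (k + j) = w" by (auto simp: E'_def \<pi>_def)
    then show "\<exists>x\<in>E'. v - \<pi> x \<in> residue_span R m n {}" using w by auto
  qed
  moreover have "isomorphic M (restriction L.L {..<k})"
    unfolding isomorphic_def
  proof (intro exI[of _ f] conjI allI impI)
    have "ground L.L \<inter> {..<k} = {..<k}" unfolding L.ground_L by (auto simp: E'_def)
    then show "bij_betw f ?E (ground (restriction L.L {..<k}))"
      using f by (simp add: restriction_def)
    fix X assume X: "X \<subseteq> ?E"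
    have fX: "f ` X \<subseteq> {..<k}" using fE X by blast
    then have fXE: "f ` X \<subseteq> E'" by (auto simp: E'_def)
    have im: "\<pi> ` (f ` X - {f x}) = \<phi> ` (X - {x})" if x: "x \<in> X" for x
    proof -
      have "inj_on f X" using f X by (auto simp: bij_betw_def intro: inj_on_subset)
      then have "f ` X - {f x} = f ` (X - {x})" using x by (auto simp: inj_on_def)
      moreover have "\<pi> ` f ` (X - {x}) = \<phi> ` (X - {x})"
        unfolding image_image using \<pi>f X by (intro image_cong) auto
      ultimately show ?thesis by simp
    qed
    have "f ` X \<in> indeps L.L \<longleftrightarrow> (\<forall>x\<in>X. \<phi> x \<notin> residue_span R m n (\<phi> ` (X - {x})))"
      using L.indeps_L_iff[of "f ` X"] fXE im \<pi>f X by (simp add: subset_iff)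
    also have "\<dots> \<longleftrightarrow> (\<forall>x\<in>X. \<phi> x \<notin> scale_fun.span (\<phi> ` (X - {x})))"
    proof (intro ball_cong refl arg_cong[of _ _ Not] span_iff)
    qed (use X in auto)
    also have "\<dots> \<longleftrightarrow> X \<in> indeps M" using \<phi>[OF X] by simp
    finally show "X \<in> indeps M \<longleftrightarrow> f ` X \<in> indeps (restriction L.L {..<k})"
      using fX by (simp add: restriction_def)
  qed
  moreover have "{..<k} \<subseteq> ground L.L" unfolding L.ground_L by (auto simp: E'_def)
  ultimately show ?thesis unfolding embeddable_in_modular_def using L.matroid_L by blast
qed

theorem theorem5p6:
  fixes M :: "'a::infinite set_system"
  assumes "matroid M"
    and "realizable_over TYPE('k::field) M"
  shows "(sticky M \<longrightarrow> modular M) \<and> (hypermodular M \<longrightarrow> embeddable_in_modular M)"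
  using realizable_sticky_modular[OF assms] realizable_embeddable_in_modular[OF assms] by blast

end
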